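(* Let $A\in\mathbb{Q}^{m\times m}$ be a positive definite symmetric matrix of bit-length $b$. Then in $\mathrm{poly}(m,b)$ time one can compute $N$ vectors $l_1,\dots,l_N\in\mathbb{Q}^m$, where $m\le N\le O(m(\log m+\log b))$, such that $A=\sum_{i=1}^N l_il_i^T$. *)

theory Defs
  imports
    Complex_Main
    "HOL-Library.Log_Nat"
    "Jordan_Normal_Form.Matrix"
begin

text \<open>
  Model of computation: while-programs over a random-access memory of integers, with logarithmic
  cost, i.e. every operation is charged according to the binary length of all numbers it touches
  (addresses included), and multiplication and division are charged as in the schoolbook algorithms.
  Up to polynomial factors the running time is that of a multitape Turing machine.
\<close>

definition int_size :: "int \<Rightarrow> nat" where
  "int_size z = 1 + nat (bitlen \<bar>z\<bar>)"  \<comment> \<open>one sign bit plus the binary digits of the absolute value\<close>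

text \<open>The memory consists of named arrays indexed by integers; a scalar variable is cell 0 of its array.\<close>

type_synonym vname = string
type_synonym state = "vname \<Rightarrow> int \<Rightarrow> int"

datatype aexp =
    Num int
  | Read vname aexp
  | Add aexp aexp
  | Sub aexp aexp
  | Mul aexp aexp
  | Div aexp aexp

datatype bexp =
    Less aexp aexp
  | BNot bexp
  | BAnd bexp bexp

datatype com =
    Skip
  | Write vname aexp aexp
  | Seq com com
  | Cond bexp com com
  | While bexp com

fun aval :: "aexp \<Rightarrow> state \<Rightarrow> int" where
  "aval (Num n) s = n"
| "aval (Read x i) s = s x (aval i s)"
| "aval (Add a b) s = aval a s + aval b s"
| "aval (Sub a b) s = aval a s - aval b s"
| "aval (Mul a b) s = aval a s * aval b s"
| "aval (Div a b) s = aval a s div aval b s"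

fun acost :: "aexp \<Rightarrow> state \<Rightarrow> nat" where
  "acost (Num n) s = int_size n"
| "acost (Read x i) s = acost i s + int_size (aval i s) + int_size (s x (aval i s))"
| "acost (Add a b) s = acost a s + acost b s + int_size (aval a s) + int_size (aval b s)"
| "acost (Sub a b) s = acost a s + acost b s + int_size (aval a s) + int_size (aval b s)"
| "acost (Mul a b) s = acost a s + acost b s + int_size (aval a s) * int_size (aval b s)"
| "acost (Div a b) s = acost a s + acost b s + int_size (aval a s) * int_size (aval b s)"

fun bval :: "bexp \<Rightarrow> state \<Rightarrow> bool" where
  "bval (Less a b) s \<longleftrightarrow> aval a s < aval b s"
| "bval (BNot p) s \<longleftrightarrow> \<not> bval p s"
| "bval (BAnd p q) s \<longleftrightarrow> bval p s \<and> bval q s"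

fun bcost :: "bexp \<Rightarrow> state \<Rightarrow> nat" where
  "bcost (Less a b) s = acost a s + acost b s + int_size (aval a s) + int_size (aval b s)"
| "bcost (BNot p) s = bcost p s + 1"
| "bcost (BAnd p q) s = bcost p s + bcost q s + 1"

text \<open>\<open>exec c s t s'\<close>: started in \<open>s\<close>, the program \<open>c\<close> halts in \<open>s'\<close> after time exactly \<open>t\<close>.\<close>

inductive exec :: "com \<Rightarrow> state \<Rightarrow> nat \<Rightarrow> state \<Rightarrow> bool" where
  Skip: "exec Skip s 1 s"
| Write: "exec (Write x i a) s
    (acost i s + acost a s + int_size (aval i s) + int_size (aval a s))
    (s(x := (s x)(aval i s := aval a s)))"
| Seq: "exec c1 s t1 s1 \<Longrightarrow> exec c2 s1 t2 s2 \<Longrightarrow> exec (Seq c1 c2) s (t1 + t2) s2"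
| CondTrue: "bval p s \<Longrightarrow> exec c1 s t s1 \<Longrightarrow> exec (Cond p c1 c2) s (bcost p s + t) s1"
| CondFalse: "\<not> bval p s \<Longrightarrow> exec c2 s t s1 \<Longrightarrow> exec (Cond p c1 c2) s (bcost p s + t) s1"
| WhileFalse: "\<not> bval p s \<Longrightarrow> exec (While p c) s (bcost p s) s"
| WhileTrue: "bval p s \<Longrightarrow> exec c s t1 s1 \<Longrightarrow> exec (While p c) s1 t2 s2 \<Longrightarrow>
    exec (While p c) s (bcost p s + t1 + t2) s2"

inductive_cases Skip_execE: "exec Skip s t s'"
  and Write_execE: "exec (Write x i a) s t s'"
  and Seq_execE: "exec (Seq c1 c2) s t s'"
  and Cond_execE: "exec (Cond p c1 c2) s t s'"
  and While_execE: "exec (While p c) s t s'"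

lemma exec_deterministic:
  "exec c s t s1 \<Longrightarrow> exec c s u s2 \<Longrightarrow> t = u \<and> s1 = s2"
proof (induction arbitrary: u s2 rule: exec.induct)
  case (Skip s)
  from Skip.prems show ?case by (rule Skip_execE) simp
next
  case (Write x i a s)
  from Write.prems show ?case by (rule Write_execE) simp
next
  case (Seq c1 s t1 s1 c2 t2 s2)
  from Seq.prems show ?case by (rule Seq_execE) (use Seq.IH in blast)
next
  case (CondTrue p s c1 t s1 c2)
  from CondTrue.prems show ?case
    by (rule Cond_execE) (use CondTrue.hyps CondTrue.IH in blast)+
next
  case (CondFalse p s c2 t s1 c1)
  from CondFalse.prems show ?case
    by (rule Cond_execE) (use CondFalse.hyps CondFalse.IH in blast)+
next
  case (WhileFalse p s c)
  from WhileFalse.prems show ?case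
    by (rule While_execE) (use WhileFalse.hyps in simp_all)
next
  case (WhileTrue p s c t1 s1 t2 s2)
  from WhileTrue.prems show ?case
    by (rule While_execE) (use WhileTrue.hyps WhileTrue.IH in blast)+
qed

text \<open>\<open>quotient_of\<close> yields the numerator and the positive denominator in lowest terms.\<close>

definition rat_size :: "rat \<Rightarrow> nat" where
  "rat_size q = int_size (fst (quotient_of q)) + int_size (snd (quotient_of q))"

definition bit_length :: "rat mat \<Rightarrow> nat" where
  "bit_length A = (\<Sum>i<dim_row A. \<Sum>j<dim_col A. rat_size (A $$ (i, j)))"

text \<open>
  Input: the dimension \<open>m\<close>, and the numerators and denominators of the entries in row-major order.
  All other cells are 0.
\<close>

definition input_state :: "rat mat \<Rightarrow> state" where
  "input_state A = (\<lambda>x k.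
     let m = int (dim_row A);
         entry = A $$ (nat (k div m), nat (k mod m))
     in if x = ''m'' \<and> k = 0 then m
        else if x = ''num'' \<and> 0 \<le> k \<and> k < m * m then fst (quotient_of entry)
        else if x = ''den'' \<and> 0 \<le> k \<and> k < m * m then snd (quotient_of entry)
        else 0)"

text \<open>
  Output: the number \<open>N\<close> of vectors, and their coordinates, stored one vector after the other
  as fractions with positive denominators, not necessarily in lowest terms.
\<close>

definition outputs_vectors :: "state \<Rightarrow> nat \<Rightarrow> rat vec list \<Rightarrow> bool" where
  "outputs_vectors s m ls \<longleftrightarrow>
     s ''N'' 0 = int (length ls) \<and>
     (\<forall>k<length ls. ls ! k \<in> carrier_vec m \<and>
        (\<forall>i<m. 0 < s ''lden'' (int (k * m + i)) \<and>
           ls ! k $ i = of_int (s ''lnum'' (int (k * m + i))) / of_int (s ''lden'' (int (k * m + i)))))"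

definition symmetric_mat :: "'a mat \<Rightarrow> bool" where
  "symmetric_mat A \<longleftrightarrow> transpose_mat A = A"

definition positive_definite :: "real mat \<Rightarrow> bool" where
  "positive_definite A \<longleftrightarrow>
     (\<forall>x \<in> carrier_vec (dim_row A). x \<noteq> 0\<^sub>v (dim_row A) \<longrightarrow> x \<bullet> (A *\<^sub>v x) > 0)"

text \<open>The rank-one matrix \<open>l l\<^sup>T\<close>.\<close>

definition outer_square :: "'a::times vec \<Rightarrow> 'a mat" where
  "outer_square l = mat (dim_vec l) (dim_vec l) (\<lambda>(i, j). l $ i * l $ j)"

definition mat_sum_list :: "nat \<Rightarrow> 'a::monoid_add mat list \<Rightarrow> 'a mat" where
  "mat_sum_list m Bs = foldr (+) Bs (0\<^sub>m m m)"

end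

theory Submission
  imports Defs "HOL-Library.Discrete_Functions" "Jordan_Normal_Form.Determinant"
begin

text \<open>
  Let \<open>D\<close> be the product of all denominators, so that \<open>Z = D\<^sup>2 A\<close> is a positive definite integer matrix.
  Fraction-free Gaussian elimination (Bareiss) gives \<open>Z = (\<Sum>k<m. u\<^sub>k u\<^sub>k\<^sup>T / (p\<^sub>k p\<^sub>k\<^sub>+\<^sub>1))\<close>, where \<open>p\<^sub>k\<close> is
  the \<open>k\<close>-th leading principal minor and \<open>u\<^sub>k\<close> the \<open>k\<close>-th pivot row. All numbers that occur are minors
  of \<open>Z\<close>, hence integers with polynomially many bits. Put \<open>n = p\<^sub>k p\<^sub>k\<^sub>+\<^sub>1\<close> and subtract greedily the
  largest square: the remainder of \<open>n\<close> is at most \<open>2 sqrt n\<close>, so \<open>n\<close> is a sum of \<open>O(log log n)\<close> squares,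
  that is, of \<open>O(log m + log b)\<close> many. Each square \<open>r\<^sup>2\<close> contributes the vector \<open>r u\<^sub>k / (n D)\<close>, because
  \<open>1 / n = n / n\<^sup>2\<close>.
\<close>

section \<open>Fraction-free elimination\<close>

text \<open>Scaling by \<open>D\<close>^2 rather than \<open>D\<close> leaves the factor 1 /
  \<open>D\<close>^2, a rational square that every vector absorbs as 1 / \<open>D\<close>. The
  weights 1 / (p_k p_{k+1}) are in general not squares of rationals; this is the obstacle to reading
  off exactly \<open>m\<close> vectors from the symmetric elimination. Lagrange's theorem would
  bound the number of squares per weight by four, but the greedy choice needs nothing beyond integer
  square roots by bisection, and its length is easy to estimate. Since every weight is a positive
  integer, it contributes at least one square, whence the lower bound \<open>m\<close> on the number
  of vectors. The running time splits into two questions: all cells stay below \<open>2 ^ w\<close>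
  for one \<open>w\<close> polynomial in \<open>b\<close>, and the number of executed commands is
  polynomial. The cost of a single command is then bounded by a syntactic constant times a square in
  \<open>w + 1\<close>.\<close>

fun schur :: "(nat \<Rightarrow> nat \<Rightarrow> 'a::field) \<Rightarrow> nat \<Rightarrow> nat \<Rightarrow> nat \<Rightarrow> 'a" where
  "schur B 0 i j = B i j"
| "schur B (Suc k) i j = schur B k i j - schur B k i k * schur B k k j / schur B k k k"

definition lead_minor :: "(nat \<Rightarrow> nat \<Rightarrow> 'a::field) \<Rightarrow> nat \<Rightarrow> 'a" where
  "lead_minor B k = (\<Prod>l<k. schur B l l l)"

text \<open>With nonzero pivots and \<open>k\<close> equal to the dimension the last term vanishes,
  leaving a sum of rank-one matrices; for smaller \<open>k\<close> it supplies the LU factorisation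
  behind the determinant formula.\<close>

lemma schur_telescope:
  "B i j = (\<Sum>l<k. schur B l i l * schur B l l j / schur B l l l) + schur B k i j"
  by (induction k) auto

text \<open>Step \<open>k\<close> subtracts from row and column \<open>k\<close> exactly what they
  contain, and rows and columns cleared earlier stay zero because each correction term has a factor
  taken from them.\<close>

lemma schur_eliminated:
  assumes "\<And>l. l < k \<Longrightarrow> schur B l l l \<noteq> 0" and "i < k \<or> j < k"
  shows "schur B k i j = 0"
  using assms
proof (induction k arbitrary: i j)
  case (Suc k)
  have IH: "schur B k i j = 0" if "i < k \<or> j < k" for i j
    using Suc.IH[of i j] Suc.prems(1) that by auto
  have "schur B k k k \<noteq> 0" using Suc.prems(1) by auto
  then show ?case
    using Suc.prems(2) IH by (auto simp: less_Suc_eq)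
qed auto

text \<open>The bordered matrix is a unit lower triangular \<open>L\<close> times an upper
  triangular \<open>U\<close> whose diagonal consists of the first \<open>k\<close> pivots and the
  Schur entry. Hence a Schur entry times the leading minor is again a minor, and an integer whenever
  \<open>B\<close> is integral.\<close>

lemma schur_eq_det:
  fixes B :: "nat \<Rightarrow> nat \<Rightarrow> 'a::field"
  assumes nz: "\<And>l. l < k \<Longrightarrow> schur B l l l \<noteq> 0"
  shows "lead_minor B k * schur B k i j =
    det (mat (Suc k) (Suc k) (\<lambda>(a, b). B (if a < k then a else i) (if b < k then b else j)))"
proof -
  \<comment> \<open>\<open>r\<close> and \<open>c\<close> send the last index \<open>k\<close> of
    the bordered matrix to \<open>i\<close> and \<open>j\<close> and fix all others.\<close>
  define r where "r a = (if a < k then a else i)" for a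
  define c where "c b = (if b < k then b else j)" for b
  define L where "L = mat (Suc k) (Suc k) (\<lambda>(a, l).
    if l < k then schur B l (r a) l / schur B l l l else if a = k then 1 else 0)"
  define U where "U = mat (Suc k) (Suc k) (\<lambda>(l, b).
    if l < k then schur B l l (c b) else if b = k then schur B k i j else 0)"
  have el: "schur B l a b = 0" if "l \<le> k" "a < l \<or> b < l" for l a b
    using schur_eliminated[of l B a b] nz that by auto
  have car: "L \<in> carrier_mat (Suc k) (Suc k)" "U \<in> carrier_mat (Suc k) (Suc k)"
    by (auto simp: L_def U_def)
  have "mat (Suc k) (Suc k) (\<lambda>(a, b). B (r a) (c b)) = L * U"
  proof (rule eq_matI)
    fix a b assume "a < dim_row (L * U)" "b < dim_col (L * U)"
    then have ab: "a < Suc k" "b < Suc k" using car by auto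
    have "(L * U) $$ (a, b) = (\<Sum>l<Suc k. L $$ (a, l) * U $$ (l, b))"
      using ab car by (auto simp: scalar_prod_def lessThan_atLeast0 intro!: sum.cong)
    \<comment> \<open>If \<open>a\<close> or \<open>b\<close> is below \<open>k\<close>, the term
      \<open>l = k\<close> of the product is zero, and so is \<open>schur B k (r a) (c b)\<close>;
      if \<open>a = b = k\<close>, both equal \<open>schur B k i j\<close>.\<close>
    also have "\<dots> = (\<Sum>l<k. schur B l (r a) l * schur B l l (c b) / schur B l l l)
        + schur B k (r a) (c b)"
      using ab el[of k a] el[of k _ b] by (auto simp: L_def U_def r_def c_def)
    also have "\<dots> = B (r a) (c b)" using schur_telescope[of B _ _ k] by simp
    finally show "mat (Suc k) (Suc k) (\<lambda>(a, b). B (r a) (c b)) $$ (a, b) = (L * U) $$ (a, b)"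
      using ab by simp
  qed (use car in auto)
  moreover have "det L = 1"
  proof -
    have "det L = prod_list (diag_mat L)"
      by (rule det_lower_triangular[OF _ car(1)]) (auto simp: L_def r_def intro!: el)
    also have "\<dots> = 1"
      unfolding prod_list_diag_prod using nz by (auto simp: L_def r_def intro!: prod.neutral)
    finally show ?thesis .
  qed
  moreover have "det U = lead_minor B k * schur B k i j"
  proof -
    have "det U = prod_list (diag_mat U)"
      by (rule det_upper_triangular[OF _ car(2)]) (auto simp: U_def c_def upper_triangular_def intro!: el)
    also have "\<dots> = (\<Prod>l<Suc k. U $$ (l, l))"
      unfolding prod_list_diag_prod using car by (simp add: lessThan_atLeast0)
    also have "\<dots> = lead_minor B k * schur B k i j"
      by (simp add: U_def c_def lead_minor_def)
    finally show ?thesis .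
  qed
  ultimately have "det (mat (Suc k) (Suc k) (\<lambda>(a, b). B (r a) (c b))) = lead_minor B k * schur B k i j"
    using det_mult[OF car] by simp
  then show ?thesis by (simp add: r_def c_def)
qed

lemma schur_symmetric:
  assumes "\<And>i j. i < m \<Longrightarrow> j < m \<Longrightarrow> B i j = B j i" and "i < m" "j < m" "k \<le> m"
  shows "schur B k i j = schur B k j i"
  using assms by (induction k arbitrary: i j) (auto simp: mult.commute)

text \<open>Stated over any ordered field so that the elimination can take place over the rationals,
  although definiteness is given over the reals.\<close>

definition pos_def_form :: "nat \<Rightarrow> (nat \<Rightarrow> nat \<Rightarrow> 'a::linordered_field) \<Rightarrow> bool" where
  "pos_def_form m B \<longleftrightarrow>
     (\<forall>x. (\<exists>i<m. x i \<noteq> 0) \<longrightarrow> (\<Sum>i<m. \<Sum>j<m. x i * B i j * x j) > 0)"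

text \<open>The form at \<open>x\<close> plus \<open>c\<close> times the \<open>k\<close>-th unit
  vector. With \<open>x = 0\<close> and \<open>c = 1\<close> it reads off a diagonal entry; with the
  optimal \<open>c\<close> it completes the square.\<close>

lemma quadratic_form_add_unit:
  fixes E :: "nat \<Rightarrow> nat \<Rightarrow> 'a::field"
  assumes "k < m"
  shows "(\<Sum>i<m. \<Sum>j<m. (x i + (if i = k then c else 0)) * E i j * (x j + (if j = k then c else 0)))
    = (\<Sum>i<m. \<Sum>j<m. x i * E i j * x j) + c * (\<Sum>i<m. x i * E i k) + c * (\<Sum>j<m. E k j * x j)
      + c\<^sup>2 * E k k"
proof -
  let ?e = "\<lambda>i. if i = k then c else 0"
  have "(\<Sum>i<m. \<Sum>j<m. (x i + ?e i) * E i j * (x j + ?e j)) =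
     (\<Sum>i<m. \<Sum>j<m. x i * E i j * x j) + (\<Sum>i<m. \<Sum>j<m. x i * E i j * ?e j)
     + (\<Sum>i<m. \<Sum>j<m. ?e i * E i j * x j) + (\<Sum>i<m. \<Sum>j<m. ?e i * E i j * ?e j)"
    by (simp only: sum.distrib[symmetric] distrib_left distrib_right add.assoc add.left_commute)
  moreover have "(\<Sum>i<m. \<Sum>j<m. x i * E i j * ?e j) = c * (\<Sum>i<m. x i * E i k)"
    using assms by (simp add: if_distrib[of "(*) _"] sum_distrib_left ac_simps cong: if_cong)
  moreover have "(\<Sum>i<m. \<Sum>j<m. ?e i * E i j * x j) = c * (\<Sum>j<m. E k j * x j)"
    using assms by (subst sum.swap)
      (simp add: if_distrib[of "(*) _"] sum_distrib_left ac_simps cong: if_cong)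
  moreover have "(\<Sum>i<m. \<Sum>j<m. ?e i * E i j * ?e j) = c\<^sup>2 * E k k"
  proof -
    have "(\<Sum>j<m. ?e i * E i j * ?e j) = (if i = k then c\<^sup>2 * E k k else 0)" for i
      using assms by (simp add: if_distrib[of "(*) _"] power2_eq_square ac_simps cong: if_cong)
    then show ?thesis using assms by simp
  qed
  ultimately show ?thesis by (simp add: algebra_simps)
qed

text \<open>Completing the square: a vector supported on \<open>{k<..<m}\<close> is extended by the \<open>k\<close>-th coordinate
  that minimises the form, and the minimum is the form of the next Schur complement.\<close>

lemma schur_pos_def:
  fixes B :: "nat \<Rightarrow> nat \<Rightarrow> 'a::linordered_field"
  assumes pd: "pos_def_form m B"
    and sym: "\<And>i j. i < m \<Longrightarrow> j < m \<Longrightarrow> B i j = B j i"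
    and "k \<le> m" "\<exists>i<m. x i \<noteq> 0" "\<And>i. i < k \<Longrightarrow> x i = 0"
  shows "(\<Sum>i<m. \<Sum>j<m. x i * schur B k i j * x j) > 0"
  using assms(3-)
proof (induction k arbitrary: x)
  case 0
  then show ?case using pd by (simp add: pos_def_form_def)
next
  case (Suc k)
  define E where "E = schur B k"
  have k: "k < m" using Suc.prems by simp
  have pos: "(\<Sum>i<m. \<Sum>j<m. x i * E i j * x j) > 0"
    if "\<exists>i<m. x i \<noteq> 0" "\<And>i. i < k \<Longrightarrow> x i = 0" for x
    unfolding E_def using Suc.IH[of x] that k by simp
  have "(\<Sum>i<m. \<Sum>j<m. (0 + (if i = k then 1 else 0)) * E i j * (0 + (if j = k then 1 else 0))) > 0"
    by (rule pos) (use k in auto)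
  then have piv: "E k k > 0" by (subst (asm) quadratic_form_add_unit[OF k]) simp
  define a where "a = (\<Sum>i<m. x i * E i k)"
  have a': "(\<Sum>j<m. E k j * x j) = a"
    unfolding a_def E_def
    by (intro sum.cong refl) (use schur_symmetric[OF sym] k in \<open>auto simp: mult.commute\<close>)
  define c where "c = - a / E k k"
  have "0 < (\<Sum>i<m. \<Sum>j<m. (x i + (if i = k then c else 0)) * E i j * (x j + (if j = k then c else 0)))"
  proof (rule pos)
    obtain i where i: "i < m" "x i \<noteq> 0" using Suc.prems by auto
    \<comment> \<open>\<open>x\<close> vanishes at \<open>k\<close>, so adding \<open>c\<close>
      there cannot cancel the nonzero coordinate.\<close>
    then have "i \<noteq> k" using Suc.prems(3)[of k] by auto
    then show "\<exists>i<m. x i + (if i = k then c else 0) \<noteq> 0" using i by (intro exI[of _ i]) auto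
  qed (use Suc.prems(3) in auto)
  also have "\<dots> = (\<Sum>i<m. \<Sum>j<m. x i * E i j * x j) - a * a / E k k"
    unfolding quadratic_form_add_unit[OF k] a' a_def[symmetric]
    using piv by (simp add: c_def field_simps power2_eq_square)
  \<comment> \<open>The square of the linear form is expanded into a double sum, which merges with
    the quadratic form into one step of the Schur recursion.\<close>
  also have "a * a / E k k = (\<Sum>i<m. \<Sum>j<m. (x i * E i k) * (E k j * x j)) / E k k"
    unfolding sum_product[symmetric] a' a_def[symmetric] by simp
  also have "(\<Sum>i<m. \<Sum>j<m. x i * E i j * x j) - \<dots> =
     (\<Sum>i<m. \<Sum>j<m. x i * schur B (Suc k) i j * x j)"
    by (simp add: E_def[symmetric] algebra_simps sum_subtractf sum_divide_distrib)
  finally show ?case .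
qed

lemma schur_pivot_pos:
  fixes B :: "nat \<Rightarrow> nat \<Rightarrow> 'a::linordered_field"
  assumes "pos_def_form m B" "\<And>i j. i < m \<Longrightarrow> j < m \<Longrightarrow> B i j = B j i" "k < m"
  shows "schur B k k k > 0"
proof -
  have "(\<Sum>i<m. \<Sum>j<m. (0 + (if i = k then 1 else 0)) * schur B k i j * (0 + (if j = k then 1 else 0))) > 0"
    by (rule schur_pos_def[OF assms(1,2)]) (use assms(3) in auto)
  then show ?thesis by (subst (asm) quadratic_form_add_unit[OF assms(3)]) simp
qed

section \<open>Integral minors: size bound and Bareiss recurrence\<close>

lemma abs_det_le:
  fixes M :: "'a::linordered_idom mat"
  assumes M: "M \<in> carrier_mat n n" and le: "\<And>i j. i < n \<Longrightarrow> j < n \<Longrightarrow> \<bar>M $$ (i, j)\<bar> \<le> X"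
  shows "\<bar>det M\<bar> \<le> of_nat (fact n) * X ^ n"
proof -
  have "\<bar>det M\<bar> \<le> (\<Sum>p\<in>{p. p permutes {0..<n}}. \<bar>signof p * (\<Prod>i = 0..<n. M $$ (i, p i))\<bar>)"
    unfolding det_def'[OF M] by (rule sum_abs)
  \<comment> \<open>Each of the \<open>n!\<close> Leibniz terms is a product of \<open>n\<close>
    entries. This is weaker than Hadamard's bound, but its logarithm is still polynomial.\<close>
  also have "\<dots> \<le> (\<Sum>p\<in>{p. p permutes {0..<n}}. X ^ n)"
  proof (rule sum_mono)
    fix p assume p: "p \<in> {p. p permutes {0..<n}}"
    have "\<bar>signof p * (\<Prod>i = 0..<n. M $$ (i, p i))\<bar> = (\<Prod>i = 0..<n. \<bar>M $$ (i, p i)\<bar>)"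
      by (simp add: abs_mult abs_prod sign_def)
    also have "\<dots> \<le> (\<Prod>i = 0..<n. X)"
      by (rule prod_mono) (use p permutes_in_image[of p "{0..<n}"] in \<open>auto intro!: le\<close>)
    finally show "\<bar>signof p * (\<Prod>i = 0..<n. M $$ (i, p i))\<bar> \<le> X ^ n" by simp
  qed
  also have "\<dots> = of_nat (fact n) * X ^ n"
    by (simp add: card_permutations)
  finally show ?thesis .
qed

text \<open>The Schur entry cleared of denominators, by \<open>schur_eq_det\<close>. Defining it as
  a bordered minor makes integrality immediate and the size a matter of bounding a determinant; the
  recurrence executed by the program becomes the statement to prove.\<close>

definition bareiss :: "(nat \<Rightarrow> nat \<Rightarrow> int) \<Rightarrow> nat \<Rightarrow> nat \<Rightarrow> nat \<Rightarrow> int" where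
  "bareiss Z k i j =
     det (mat (Suc k) (Suc k) (\<lambda>(a, b). Z (if a < k then a else i) (if b < k then b else j)))"

text \<open>The leading principal minor of order \<open>k\<close>, which appears on the diagonal
  after \<open>k - 1\<close> steps. Order 0 is the empty determinant 1, the first divisor of the
  recurrence.\<close>

definition bareiss_pivot :: "(nat \<Rightarrow> nat \<Rightarrow> int) \<Rightarrow> nat \<Rightarrow> int" where
  "bareiss_pivot Z k = (if k = 0 then 1 else bareiss Z (k - 1) (k - 1) (k - 1))"

lemma bareiss_0: "bareiss Z 0 i j = Z i j"
  by (simp add: bareiss_def det_single)

locale pos_def_int =
  fixes m :: nat and Z :: "nat \<Rightarrow> nat \<Rightarrow> int"
  assumes sym: "\<And>i j. i < m \<Longrightarrow> j < m \<Longrightarrow> Z i j = Z j i"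
    and pd: "pos_def_form m (\<lambda>i j. rat_of_int (Z i j))"
begin

abbreviation "E \<equiv> schur (\<lambda>i j. rat_of_int (Z i j))"
abbreviation "p \<equiv> lead_minor (\<lambda>i j. rat_of_int (Z i j))"

lemma E_pivot_pos: "k < m \<Longrightarrow> E k k k > 0"
  by (rule schur_pivot_pos[OF pd]) (auto simp: sym)

lemma lead_minor_pos: "k \<le> m \<Longrightarrow> p k > 0"
  unfolding lead_minor_def by (auto intro!: prod_pos E_pivot_pos)

lemma of_int_bareiss: "k \<le> m \<Longrightarrow> rat_of_int (bareiss Z k i j) = p k * E k i j"
proof -
  assume k: "k \<le> m"
  have nz: "E l l l \<noteq> 0" if "l < k" for l using E_pivot_pos[of l] k that by simp
  show ?thesis
    unfolding bareiss_def of_int_hom.hom_det[symmetric]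
    by (subst schur_eq_det[OF nz]) (auto intro!: arg_cong[of _ _ det] eq_matI simp del: of_int_hom.hom_det)
qed

lemma of_int_bareiss_pivot: "k \<le> m \<Longrightarrow> rat_of_int (bareiss_pivot Z k) = p k"
  by (cases k) (auto simp: bareiss_pivot_def of_int_bareiss lead_minor_def)

lemma bareiss_pivot_pos: "k \<le> m \<Longrightarrow> bareiss_pivot Z k > 0"
  using of_int_bareiss_pivot[of k] lead_minor_pos[of k] by (metis of_int_0_less_iff)

text \<open>Sylvester's identity, so the integer division is exact. Since
  \<open>p (Suc k) = p k * E k k k\<close>, both the numerator and the pivot times the new entry
  equal \<open>(p k)^2 * (E k k k * E k i j - E k i k * E k k j)\<close> over the rationals.\<close>

lemma bareiss_Suc:
  assumes "k < m"
  shows "bareiss Z (Suc k) i j =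
    (bareiss Z k k k * bareiss Z k i j - bareiss Z k i k * bareiss Z k k j) div bareiss_pivot Z k"
proof -
  have nz: "p k \<noteq> 0" "E k k k \<noteq> 0" using lead_minor_pos[of k] E_pivot_pos[of k] assms by auto
  have "rat_of_int (bareiss_pivot Z k * bareiss Z (Suc k) i j) =
    rat_of_int (bareiss Z k k k * bareiss Z k i j - bareiss Z k i k * bareiss Z k k j)"
    using assms nz by (simp add: of_int_bareiss of_int_bareiss_pivot lead_minor_def[of _ "Suc k"]
      lead_minor_def[of _ k, symmetric] field_simps)
  then have "bareiss_pivot Z k * bareiss Z (Suc k) i j =
    bareiss Z k k k * bareiss Z k i j - bareiss Z k i k * bareiss Z k k j"
    by (simp only: of_int_eq_iff)
  then show ?thesis
    using bareiss_pivot_pos[of k] assms by (metis less_imp_le nonzero_mult_div_cancel_left less_irrefl)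
qed

text \<open>The telescoped sum has no remainder after \<open>m\<close> steps. Expanding a summand by
  \<open>(p k)^2\<close> turns its numerator into Bareiss entries and its denominator into
  \<open>p k * p (Suc k)\<close>; symmetry replaces the column factor \<open>E k i k\<close> by an
  entry of the pivot row.\<close>

lemma bareiss_decomposition:
  assumes "i < m" "j < m"
  shows "rat_of_int (Z i j) = (\<Sum>k<m. rat_of_int (bareiss Z k k i * bareiss Z k k j)
      / rat_of_int (bareiss_pivot Z k * bareiss_pivot Z (Suc k)))"
proof -
  have "E m i j = 0"
    using schur_eliminated[of m "\<lambda>i j. rat_of_int (Z i j)" i j] E_pivot_pos assms
    by (metis less_irrefl)
  then have "rat_of_int (Z i j) = (\<Sum>k<m. E k i k * E k k j / E k k k)"
    using schur_telescope[of "\<lambda>i j. rat_of_int (Z i j)" i j m] by simp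
  also have "\<dots> = (\<Sum>k<m. rat_of_int (bareiss Z k k i * bareiss Z k k j)
      / rat_of_int (bareiss_pivot Z k * bareiss_pivot Z (Suc k)))"
  proof (rule sum.cong[OF refl])
    fix k assume "k \<in> {..<m}"
    then have k: "k < m" by simp
    have "E k i k = E k k i"
      by (rule schur_symmetric[of m]) (use sym assms k in auto)
    moreover have "p k \<noteq> 0" "E k k k \<noteq> 0" using lead_minor_pos[of k] E_pivot_pos[of k] k by auto
    ultimately show "E k i k * E k k j / E k k k = rat_of_int (bareiss Z k k i * bareiss Z k k j)
      / rat_of_int (bareiss_pivot Z k * bareiss_pivot Z (Suc k))"
      using k by (simp add: of_int_bareiss of_int_bareiss_pivot lead_minor_def[of _ "Suc k"]
        lead_minor_def[of _ k, symmetric] field_simps)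
  qed
  finally show ?thesis .
qed

end

lemma fact_le_two_power: "fact n \<le> (2::nat) ^ (n * n)"
proof -
  have "fact n \<le> (of_nat (n ^ n) :: nat)" by (rule fact_le_power)
  also have "n ^ n \<le> (2 ^ n) ^ n" by (rule power_mono) simp_all
  finally show ?thesis by (simp add: power_mult)
qed

lemma abs_bareiss_le:
  assumes "\<And>i j. i < m \<Longrightarrow> j < m \<Longrightarrow> \<bar>Z i j\<bar> \<le> 2 ^ v" and "k < m" "i < m" "j < m"
  shows "\<bar>bareiss Z k i j\<bar> \<le> 2 ^ (m * m + v * m)"
proof -
  have "\<bar>bareiss Z k i j\<bar> \<le> of_nat (fact (Suc k)) * (2 ^ v) ^ Suc k"
    unfolding bareiss_def by (rule abs_det_le) (use assms in auto)
  also have "\<dots> \<le> of_nat (2 ^ (Suc k * Suc k)) * (2 ^ v) ^ Suc k"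
    by (intro mult_right_mono of_nat_mono fact_le_two_power) auto
  also have "\<dots> = 2 ^ (Suc k * Suc k + v * Suc k)"
    by (simp only: power_add power_mult of_nat_power of_nat_numeral)
  also have "\<dots> \<le> 2 ^ (m * m + v * m)"
    by (intro power_increasing add_mono mult_mono) (use assms in auto)
  finally show ?thesis .
qed

section \<open>Greedy sums of squares\<close>

text \<open>The number of squares found by the greedy method. It controls the number of vectors and
  is also the exact variant of the loop in \<open>split_squares\<close>.\<close>

function greedy_squares :: "nat \<Rightarrow> nat" where
  "greedy_squares n = (if n = 0 then 0 else Suc (greedy_squares (n - (floor_sqrt n)\<^sup>2)))"
  by auto
termination by (relation "measure id") auto

declare greedy_squares.simps [simp del]

lemma greedy_squares_0 [simp]: "greedy_squares 0 = 0"
  by (simp add: greedy_squares.simps)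

lemma greedy_squares_step:
  "n > 0 \<Longrightarrow> greedy_squares n = Suc (greedy_squares (n - (floor_sqrt n)\<^sup>2))"
  by (subst greedy_squares.simps) simp

text \<open>Maximality of the root \<open>r\<close> gives \<open>n < (r + 1)^2\<close>, so the
  remainder is at most \<open>2 * r\<close>. The squared form keeps the estimate inside the natural
  numbers.\<close>

lemma greedy_remainder: "(n - (floor_sqrt n)\<^sup>2)\<^sup>2 \<le> 4 * n"
proof -
  let ?r = "floor_sqrt n"
  have "n - ?r\<^sup>2 \<le> 2 * ?r" using Suc_floor_sqrt_power2_gt[of n] by (simp add: power2_eq_square)
  then have "(n - ?r\<^sup>2)\<^sup>2 \<le> (2 * ?r)\<^sup>2" by (rule power_mono) simp
  also have "\<dots> = 4 * ?r\<^sup>2" by (simp add: power_mult_distrib)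
  also have "\<dots> \<le> 4 * n" by simp
  finally show ?thesis .
qed

text \<open>One greedy step maps \<open>n\<close> to at most \<open>2 * sqrt n\<close>, so it halves the exponent.\<close>

lemma greedy_squares_le: "n < 4 * 2 ^ (2 ^ j) \<Longrightarrow> greedy_squares n \<le> j + 7"
proof (induction j arbitrary: n)
  case 0
  \<comment> \<open>For \<open>j = 0\<close> the hypothesis reads \<open>n < 8\<close>, and every
    greedy step lowers \<open>n\<close> by at least one. This is the origin of the 7.\<close>
  have "greedy_squares n \<le> n" for n
  proof (induction n rule: less_induct)
    case (less n)
    show ?case
    proof (cases "n = 0")
      case False
      then have "n - (floor_sqrt n)\<^sup>2 < n" by simp
      from less[OF this] show ?thesis using False \<open>_ < n\<close> by (simp add: greedy_squares_step)
    qed simp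
  qed
  from this[of n] 0 show ?case by simp
next
  case (Suc j)
  show ?case
  proof (cases "n = 0")
    case False
    let ?r = "n - (floor_sqrt n)\<^sup>2"
    \<comment> \<open>The factor 4 reproduces itself: if \<open>n < 4 * X^2\<close>, then the
      squared remainder is below \<open>16 * X^2 = (4 * X)^2\<close>.\<close>
    have "?r\<^sup>2 < (4 * 2 ^ (2 ^ j))\<^sup>2"
      using greedy_remainder[of n] Suc.prems
      by (simp add: power_mult_distrib power_mult[symmetric] mult.commute)
    then have "?r < 4 * 2 ^ (2 ^ j)" by (rule power_less_imp_less_base) simp
    from Suc.IH[OF this] show ?thesis using False by (simp add: greedy_squares_step)
  qed simp
qed

section \<open>A program logic with running times\<close>

lemma int_size_le_iff: "int_size z \<le> Suc w \<longleftrightarrow> \<bar>z\<bar> < 2 ^ w"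
  using bitlen_le_iff_power[of "\<bar>z\<bar>" "int w"] bitlen_nonneg[of "\<bar>z\<bar>"]
  by (auto simp: int_size_def nat_le_iff)

lemma int_size_pos: "1 \<le> int_size z"
  by (simp add: int_size_def)

lemma abs_less_two_power_int_size: "\<bar>z\<bar> < 2 ^ (int_size z - 1)"
  using int_size_le_iff[of z "int_size z - 1"] int_size_pos[of z] by simp

text \<open>One bit more than the larger operand would be the sharp bound. The sum of the sizes is
  used so that addition, subtraction and multiplication share one additive rule in
  \<open>asize\<close>.\<close>

lemma int_size_add: "int_size (a + b) \<le> int_size a + int_size b"
proof -
  let ?u = "int_size a - 1" and ?v = "int_size b - 1"
  have "\<bar>a\<bar> < 2 ^ (?u + ?v)" "\<bar>b\<bar> < 2 ^ (?u + ?v)"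
    using abs_less_two_power_int_size[of a] abs_less_two_power_int_size[of b]
      power_increasing[of ?u "?u + ?v" "2::int"] power_increasing[of ?v "?u + ?v" "2::int"]
    by linarith+
  then have "\<bar>a + b\<bar> < 2 ^ (?u + ?v + 1)" by simp
  then have "int_size (a + b) \<le> Suc (?u + ?v + 1)" by (simp only: int_size_le_iff)
  then show ?thesis using int_size_pos[of a] int_size_pos[of b] by linarith
qed

lemma int_size_uminus [simp]: "int_size (- a) = int_size a"
  by (simp add: int_size_def)

lemma int_size_diff: "int_size (a - b) \<le> int_size a + int_size b"
  using int_size_add[of a "- b"] by simp

lemma int_size_mult: "int_size (a * b) \<le> int_size a + int_size b"
proof -
  let ?u = "int_size a - 1" and ?v = "int_size b - 1"
  have "\<bar>a * b\<bar> < 2 ^ ?u * 2 ^ ?v"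
    unfolding abs_mult
    by (intro mult_strict_mono' abs_less_two_power_int_size) auto
  then have "int_size (a * b) \<le> Suc (?u + ?v)" by (simp only: int_size_le_iff power_add)
  then show ?thesis using int_size_pos[of a] int_size_pos[of b] by linarith
qed

text \<open>\<open>div\<close> rounds down, yet for \<open>a < 0 < b\<close> the quotient stays
  between \<open>a\<close> and 0. A negative divisor is reduced to a positive one by negating both
  arguments, and division by zero yields zero.\<close>

lemma abs_div_le:
  fixes a b :: int
  shows "\<bar>a div b\<bar> \<le> \<bar>a\<bar>"
proof -
  have le: "\<bar>a div b\<bar> \<le> \<bar>a\<bar>" if "b > 0" for a b :: int
  proof (cases "a \<ge> 0")
    case True
    then show ?thesis using that zdiv_mono2[of a 1 b] by (simp add: pos_imp_zdiv_nonneg_iff)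
  next
    case False
    then have "a \<le> a div b" using zdiv_mono2_neg[of a 1 b] that by simp
    moreover have "a div b < 0" using False that by (simp add: neg_imp_zdiv_neg_iff div_neg_pos_less0)
    ultimately show ?thesis by simp
  qed
  show ?thesis
  proof (cases "b > 0")
    case False
    then show ?thesis using le[of "- b" "- a"] by (cases "b = 0") simp_all
  qed (rule le)
qed

lemma int_size_div: "int_size (a div b) \<le> int_size a"
proof -
  have "\<bar>a div b\<bar> < 2 ^ (int_size a - 1)"
    using abs_div_le[of a b] abs_less_two_power_int_size[of a] by linarith
  then show ?thesis using int_size_le_iff[of "a div b" "int_size a - 1"] int_size_pos[of a] by simp
qed

text \<open>In a state whose cells have at most \<open>w\<close> bits, an expression has size at most linear and cost
  at most quadratic in \<open>w + 1\<close>, with the following syntactic coefficients.\<close>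

definition bounded :: "nat \<Rightarrow> state \<Rightarrow> bool" where
  "bounded w s \<longleftrightarrow> (\<forall>x i. \<bar>s x i\<bar> < 2 ^ w)"

fun asize :: "aexp \<Rightarrow> nat" where
  "asize (Num n) = int_size n"
| "asize (Read x i) = 1"
| "asize (Add a b) = asize a + asize b"
| "asize (Sub a b) = asize a + asize b"
| "asize (Mul a b) = asize a + asize b"
| "asize (Div a b) = asize a"

fun acoeff :: "aexp \<Rightarrow> nat" where
  "acoeff (Num n) = int_size n"
| "acoeff (Read x i) = acoeff i + asize i + 1"
| "acoeff (Add a b) = acoeff a + acoeff b + asize a + asize b"
| "acoeff (Sub a b) = acoeff a + acoeff b + asize a + asize b"
| "acoeff (Mul a b) = acoeff a + acoeff b + asize a * asize b"
| "acoeff (Div a b) = acoeff a + acoeff b + asize a * asize b"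

fun bcoeff :: "bexp \<Rightarrow> nat" where
  "bcoeff (Less a b) = acoeff a + acoeff b + asize a + asize b"
| "bcoeff (BNot p) = bcoeff p + 1"
| "bcoeff (BAnd p q) = bcoeff p + bcoeff q + 1"

text \<open>A loop body is counted once; its repetition enters through the step number of
  \<open>runs\<close>.\<close>

fun ccoeff :: "com \<Rightarrow> nat" where
  "ccoeff Skip = 1"
| "ccoeff (Write x i a) = acoeff i + acoeff a + asize i + asize a"
| "ccoeff (Seq c d) = ccoeff c + ccoeff d"
| "ccoeff (Cond p c d) = bcoeff p + ccoeff c + ccoeff d"
| "ccoeff (While p c) = bcoeff p + ccoeff c"

lemma boundedD: "bounded w s \<Longrightarrow> \<bar>s x i\<bar> < 2 ^ w"
  by (simp add: bounded_def)

lemma bounded_update: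
  "bounded w s \<Longrightarrow> (\<And>j. \<bar>f j\<bar> < 2 ^ w) \<Longrightarrow> \<bar>v\<bar> < 2 ^ w \<Longrightarrow> bounded w (s(x := f(i := v)))"
  by (simp add: bounded_def)

lemma int_size_aval:
  assumes "bounded w s"
  shows "int_size (aval a s) \<le> asize a * Suc w"
proof (induction a)
  case (Num n)
  then show ?case by simp
next
  case (Read x i)
  then show ?case using assms by (simp add: bounded_def int_size_le_iff del: mult_Suc_right)
next
  case (Add a b)
  then show ?case using int_size_add[of "aval a s" "aval b s"] by (simp add: algebra_simps)
next
  case (Sub a b)
  then show ?case using int_size_diff[of "aval a s" "aval b s"] by (simp add: algebra_simps)
next
  case (Mul a b)
  then show ?case using int_size_mult[of "aval a s" "aval b s"] by (simp add: algebra_simps)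
next
  case (Div a b)
  then show ?case using int_size_div[of "aval a s" "aval b s"] by (simp add: algebra_simps)
qed

lemma int_size_aval_square:
  assumes "bounded w s"
  shows "int_size (aval a s) \<le> asize a * (Suc w)\<^sup>2"
proof -
  have "asize a * Suc w \<le> asize a * (Suc w)\<^sup>2"
    by (intro mult_left_mono) (simp_all add: power2_eq_square)
  then show ?thesis using int_size_aval[OF assms, of a] by linarith
qed

text \<open>Values of subexpressions have size linear in \<open>w + 1\<close>, however deep the
  nesting, so a product of two sizes is quadratic and the linear charges are absorbed.\<close>

lemma acost_le:
  assumes "bounded w s"
  shows "acost a s \<le> acoeff a * (Suc w)\<^sup>2"
proof -
  define u where "u = (Suc w)\<^sup>2"
  have u: "1 \<le> u" by (simp add: u_def)
  have sz: "int_size (aval a s) \<le> asize a * u" for a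
    using int_size_aval_square[OF assms, of a] by (simp add: u_def)
  have pr: "int_size (aval a s) * int_size (aval b s) \<le> asize a * asize b * u" for a b
    using mult_mono[OF int_size_aval[OF assms, of a] int_size_aval[OF assms, of b]]
    by (simp add: u_def power2_eq_square algebra_simps)
  show ?thesis
    unfolding u_def[symmetric]
  proof (induction a)
    case (Num n)
    show ?case using mult_le_mono2[OF u, of "int_size n"] by simp
  next
    case (Read x i)
    then show ?case using sz[of i] sz[of "Read x i"] by (simp add: algebra_simps)
  next
    case (Add a b)
    then show ?case using sz[of a] sz[of b] by (simp add: algebra_simps)
  next
    case (Sub a b)
    then show ?case using sz[of a] sz[of b] by (simp add: algebra_simps)
  next
    case (Mul a b)
    then show ?case using pr[of a b] by (simp add: algebra_simps)
  next
    case (Div a b)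
    then show ?case using pr[of a b] by (simp add: algebra_simps)
  qed
qed

lemma bcost_le:
  assumes "bounded w s"
  shows "bcost p s \<le> bcoeff p * (Suc w)\<^sup>2"
proof (induction p)
  case (Less a b)
  then show ?case
    using acost_le[OF assms, of a] acost_le[OF assms, of b]
      int_size_aval_square[OF assms, of a] int_size_aval_square[OF assms, of b]
    by (simp add: distrib_right)
next
  case (BNot p)
  then show ?case by (simp add: distrib_right power2_eq_square)
next
  case (BAnd p q)
  then show ?case by (simp add: distrib_right power2_eq_square)
qed

text \<open>The program is charged \<open>n\<close> units of \<open>ccoeff c * (w + 1)\<^sup>2\<close>. Keeping the syntactic factor inside
  the unit makes step counts add up under composition, without evaluating any constant.\<close>

definition runs :: "nat \<Rightarrow> com \<Rightarrow> state \<Rightarrow> nat \<Rightarrow> (state \<Rightarrow> bool) \<Rightarrow> bool" where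
  "runs w c s n Q \<longleftrightarrow> (\<exists>t s'. exec c s t s' \<and> t \<le> n * (ccoeff c * (Suc w)\<^sup>2) \<and> Q s')"

lemma runs_mono:
  assumes "runs w c s n Q" "n \<le> n'" "\<And>s'. Q s' \<Longrightarrow> Q' s'"
  shows "runs w c s n' Q'"
proof -
  obtain t s' where "exec c s t s'" "t \<le> n * (ccoeff c * (Suc w)\<^sup>2)" "Q s'"
    using assms(1) by (auto simp: runs_def)
  moreover have "n * (ccoeff c * (Suc w)\<^sup>2) \<le> n' * (ccoeff c * (Suc w)\<^sup>2)"
    using assms(2) by (rule mult_right_mono) simp
  ultimately show ?thesis unfolding runs_def using assms(3) by (meson order_trans)
qed

lemma runs_Write:
  assumes "bounded w s" "Q (s(x := (s x)(aval i s := aval a s)))"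
  shows "runs w (Write x i a) s 1 Q"
proof -
  have "acost i s + acost a s + int_size (aval i s) + int_size (aval a s)
      \<le> 1 * (ccoeff (Write x i a) * (Suc w)\<^sup>2)"
    using acost_le[OF assms(1), of i] acost_le[OF assms(1), of a]
      int_size_aval_square[OF assms(1), of i] int_size_aval_square[OF assms(1), of a]
    by (simp add: distrib_right)
  then show ?thesis unfolding runs_def using exec.Write assms(2) by blast
qed

text \<open>The second run is nested in the postcondition of the first, so repeated application
  executes a program symbolically without intermediate assertions.\<close>

lemma runs_Seq:
  assumes "runs w c s n (\<lambda>s'. runs w d s' n' Q)"
  shows "runs w (Seq c d) s (n + n') Q"
proof -
  obtain t s1 where 1: "exec c s t s1" "t \<le> n * (ccoeff c * (Suc w)\<^sup>2)" "runs w d s1 n' Q"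
    using assms by (auto simp: runs_def)
  then obtain t' s2 where 2: "exec d s1 t' s2" "t' \<le> n' * (ccoeff d * (Suc w)\<^sup>2)" "Q s2"
    by (auto simp: runs_def)
  have "t + t' \<le> (n + n') * (ccoeff (Seq c d) * (Suc w)\<^sup>2)"
    using 1(2) 2(2) by (simp add: algebra_simps)
  then show ?thesis unfolding runs_def using exec.Seq[OF 1(1) 2(1)] 2(3) by blast
qed

lemma runs_Cond:
  assumes "bounded w s" "bval p s \<Longrightarrow> runs w c s n Q" "\<not> bval p s \<Longrightarrow> runs w d s n Q"
  shows "runs w (Cond p c d) s (n + 1) Q"
proof (cases "bval p s")
  case True
  then obtain t s' where 1: "exec c s t s'" "t \<le> n * (ccoeff c * (Suc w)\<^sup>2)" "Q s'"
    using assms(2) by (auto simp: runs_def)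
  have "bcost p s + t \<le> (n + 1) * (ccoeff (Cond p c d) * (Suc w)\<^sup>2)"
    using bcost_le[OF assms(1), of p] 1(2) by (simp add: algebra_simps)
  then show ?thesis unfolding runs_def using exec.CondTrue[OF True 1(1)] 1(3) by blast
next
  case False
  then obtain t s' where 1: "exec d s t s'" "t \<le> n * (ccoeff d * (Suc w)\<^sup>2)" "Q s'"
    using assms(3) by (auto simp: runs_def)
  have "bcost p s + t \<le> (n + 1) * (ccoeff (Cond p c d) * (Suc w)\<^sup>2)"
    using bcost_le[OF assms(1), of p] 1(2) by (simp add: algebra_simps)
  then show ?thesis unfolding runs_def using exec.CondFalse[OF False 1(1)] 1(3) by blast
qed

text \<open>\<open>k\<close> bounds the remaining rounds and may overestimate them, because
  \<open>exit\<close> accepts every \<open>k\<close>. A round takes \<open>n\<close> units for the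
  body and one for the test; the extra round pays for the final failing test.\<close>

lemma runs_While:
  assumes "I k s"
    and bd: "\<And>k s. I k s \<Longrightarrow> bounded w s"
    and step: "\<And>k s. I k s \<Longrightarrow> bval p s \<Longrightarrow> k > 0 \<and> runs w c s n (I (k - 1))"
    and exit: "\<And>k s. I k s \<Longrightarrow> \<not> bval p s \<Longrightarrow> Q s"
  shows "runs w (While p c) s ((k + 1) * (n + 1)) Q"
  using assms(1)
proof (induction k arbitrary: s rule: less_induct)
  case (less k)
  define u where "u = (Suc w)\<^sup>2"
  have b: "bcost p s \<le> bcoeff p * u" using bcost_le[OF bd[OF less.prems]] by (simp add: u_def)
  show ?case
  proof (cases "bval p s")
    case True
    then have k: "k > 0" and r: "runs w c s n (I (k - 1))" using step[OF less.prems] by auto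
    then obtain t s1 where 1: "exec c s t s1" "t \<le> n * (ccoeff c * u)" "I (k - 1) s1"
      by (auto simp: runs_def u_def)
    obtain t' s2 where 2: "exec (While p c) s1 t' s2"
        "t' \<le> (k - 1 + 1) * (n + 1) * (ccoeff (While p c) * u)" "Q s2"
      using less.IH[OF _ 1(3)] k by (auto simp: runs_def u_def)
    have "bcost p s + t \<le> (n + 1) * (ccoeff (While p c) * u)"
      using b 1(2) by (simp add: algebra_simps)
    then have "bcost p s + t + t' \<le> (k + 1) * (n + 1) * (ccoeff (While p c) * u)"
      using 2(2) k by (simp add: distrib_right add_mult_distrib)
    then show ?thesis unfolding runs_def u_def[symmetric]
      using exec.WhileTrue[OF True 1(1) 2(1)] 2(3) by blast
  next
    case False
    have "bcost p s \<le> 1 * (ccoeff (While p c) * u)" using b by (simp add: algebra_simps)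
    also have "\<dots> \<le> (k + 1) * (n + 1) * (ccoeff (While p c) * u)"
      by (intro mult_right_mono) auto
    finally show ?thesis unfolding runs_def u_def[symmetric]
      using exec.WhileFalse[OF False] exit[OF less.prems False] by blast
  qed
qed

abbreviation V :: "vname \<Rightarrow> aexp" where "V x \<equiv> Read x (Num 0)"
abbreviation Assign :: "vname \<Rightarrow> aexp \<Rightarrow> com" where "Assign x a \<equiv> Write x (Num 0) a"
abbreviation Incr :: "vname \<Rightarrow> com" where "Incr x \<equiv> Assign x (Add (V x) (Num 1))"

lemma runs_For:
  assumes "I 0 s"
    and inv: "\<And>t s. I t s \<Longrightarrow> t \<le> l \<Longrightarrow> bounded w s \<and> s x 0 = int t \<and> aval e s = int l"
    and step: "\<And>t s. I t s \<Longrightarrow> t < l \<Longrightarrow> runs w c s n (I (Suc t))"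
    and exit: "\<And>s. I l s \<Longrightarrow> Q s"
  shows "runs w (While (Less (V x) e) c) s ((l + 1) * (n + 1)) Q"
\<comment> \<open>Counting \<open>t\<close> up to \<open>l\<close> is counting the remaining rounds
  \<open>k = l - t\<close> down.\<close>
proof (rule runs_While[where I = "\<lambda>k s. k \<le> l \<and> I (l - k) s"])
  fix k s
  assume I: "k \<le> l \<and> I (l - k) s"
  note i = inv[of "l - k" s]
  show "bounded w s" using i I by simp
  {
    assume "bval (Less (V x) e) s"
    then have k: "k > 0" using i I by simp
    with I have "runs w c s n (I (Suc (l - k)))" by (intro step) auto
    moreover have "Suc (l - k) = l - (k - 1)" using k I by linarith
    moreover have "k - 1 \<le> l" using I by linarith
    ultimately show "k > 0 \<and> runs w c s n (\<lambda>s. k - 1 \<le> l \<and> I (l - (k - 1)) s)"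
      using k by (simp only: simp_thms)
  }
  assume "\<not> bval (Less (V x) e) s"
  then have "k = 0" using i I by simp
  then show "Q s" using exit I by simp
qed (use assms(1) in auto)

section \<open>The program\<close>

text \<open>Cell \<open>(k m + i) m + j\<close> of array \<open>F\<close> holds the entry \<open>(i, j)\<close> after \<open>k\<close> elimination steps.
  The pivots lie on the diagonal cells \<open>k (m\<^sup>2 + m + 1)\<close>; the initial pivot 1 is stored
  at the negative index obtained for \<open>k = -1\<close>.\<close>

definition diag_index :: "aexp \<Rightarrow> aexp" where
  "diag_index k = Mul k (Add (Mul (V ''m'') (V ''m'')) (Add (V ''m'') (Num 1)))"

definition pivot_product :: aexp where
  "pivot_product = Mul (Read ''F'' (diag_index (V ''k'')))
     (Read ''F'' (diag_index (Sub (V ''k'') (Num 1))))"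

text \<open>The counter \<open>t\<close> starts at 0 here, as does \<open>N\<close> in
  \<open>split_pivots\<close>, because the input state is zero outside the input cells.\<close>

definition common_denominator :: com where
  "common_denominator =
     Seq (Assign ''D'' (Num 1))
         (While (Less (V ''t'') (Mul (V ''m'') (V ''m'')))
           (Seq (Assign ''D'' (Mul (V ''D'') (Read ''den'' (V ''t''))))
                (Incr ''t'')))"

definition clear_denominators :: com where
  "clear_denominators =
     Seq (Assign ''t'' (Num 0))
         (While (Less (V ''t'') (Mul (V ''m'') (V ''m'')))
           (Seq (Write ''F'' (V ''t'')
                  (Mul (Mul (V ''D'') (Div (V ''D'') (Read ''den'' (V ''t'')))) (Read ''num'' (V ''t''))))
                (Incr ''t'')))"

text \<open>One counter replaces three nested loops: \<open>t\<close> is the address of entry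
  \<open>(i, j)\<close> in layer \<open>k\<close>, and the new value goes \<open>m * m\<close> cells
  higher, into layer \<open>k + 1\<close>. Earlier layers are never overwritten, so all operands of
  the recurrence remain available: \<open>t - j + k\<close> addresses entry \<open>(i, k)\<close>,
  and \<open>k * (m + 1) * m + j\<close> addresses entry \<open>(k, j)\<close>. The last layer is
  \<open>m - 1\<close>, hence \<open>(m - 1) * m * m\<close> rounds.\<close>

definition eliminate :: com where
  "eliminate =
     Seq (Write ''F'' (diag_index (Num (- 1))) (Num 1))
    (Seq (Assign ''t'' (Num 0))
         (While (Less (V ''t'') (Mul (Mul (Sub (V ''m'') (Num 1)) (V ''m'')) (V ''m'')))
           (Seq (Assign ''k'' (Div (V ''t'') (Mul (V ''m'') (V ''m''))))
           (Seq (Assign ''j'' (Sub (V ''t'') (Mul (V ''m'') (Div (V ''t'') (V ''m'')))))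
           (Seq (Write ''F'' (Add (V ''t'') (Mul (V ''m'') (V ''m'')))
                  (Div (Sub (Mul (Read ''F'' (diag_index (V ''k''))) (Read ''F'' (V ''t'')))
                            (Mul (Read ''F'' (Add (Sub (V ''t'') (V ''j'')) (V ''k'')))
                                 (Read ''F'' (Add (Mul (Mul (V ''k'') (Add (V ''m'') (Num 1))) (V ''m''))
                                                  (V ''j'')))))
                       (Read ''F'' (diag_index (Sub (V ''k'') (Num 1))))))
                (Incr ''t''))))))"

definition integer_sqrt :: com where
  "integer_sqrt =
     Seq (Assign ''lo'' (Num 0))
    (Seq (Assign ''hi'' (Add (V ''n'') (Num 1)))
         (While (Less (Add (V ''lo'') (Num 1)) (V ''hi''))
           (Seq (Assign ''mid'' (Div (Add (V ''lo'') (V ''hi'')) (Num 2)))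
                (Cond (Less (V ''n'') (Mul (V ''mid'') (V ''mid'')))
                  (Assign ''hi'' (V ''mid''))
                  (Assign ''lo'' (V ''mid''))))))"

text \<open>\<open>R\<close> receives a root and \<open>K\<close> the pivot it belongs to, so one
  flat list of \<open>N\<close> pairs describes all vectors.\<close>

definition split_squares :: com where
  "split_squares =
     While (Less (Num 0) (V ''n''))
       (Seq integer_sqrt
       (Seq (Write ''R'' (V ''N'') (V ''lo''))
       (Seq (Write ''K'' (V ''N'') (V ''k''))
       (Seq (Assign ''n'' (Sub (V ''n'') (Mul (V ''lo'') (V ''lo''))))
            (Incr ''N'')))))"

definition split_pivots :: com where
  "split_pivots =
     Seq (Assign ''k'' (Num 0))
         (While (Less (V ''k'') (V ''m''))
           (Seq (Assign ''n'' pivot_product)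
           (Seq split_squares
                (Incr ''k''))))"

definition write_vectors :: com where
  "write_vectors =
     Seq (Assign ''t'' (Num 0))
         (While (Less (V ''t'') (Mul (V ''N'') (V ''m'')))
           (Seq (Assign ''q'' (Div (V ''t'') (V ''m'')))
           (Seq (Assign ''k'' (Read ''K'' (V ''q'')))
           (Seq (Write ''lnum'' (V ''t'')
                  (Mul (Read ''R'' (V ''q''))
                       (Read ''F'' (Add (Mul (Mul (V ''k'') (Add (V ''m'') (Num 1))) (V ''m''))
                                        (Sub (V ''t'') (Mul (V ''m'') (V ''q'')))))))
           (Seq (Write ''lden'' (V ''t'') (Mul (V ''D'') pivot_product))
                (Incr ''t''))))))"

definition square_decomposition :: com where
  "square_decomposition =
     Seq common_denominator (Seq clear_denominators (Seq eliminate (Seq split_pivots write_vectors)))"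

section \<open>Correctness and step counts of the program\<close>

lemma integer_sqrt_runs:
  assumes "bounded w s" "s ''n'' 0 = int n" "int n + 1 < 2 ^ w"
  shows "runs w integer_sqrt s (1 + (1 + (w + 1) * ((1 + (1 + 1)) + 1)))
    (\<lambda>s'. bounded w s' \<and> s' ''lo'' 0 = int (floor_sqrt n) \<and>
      (\<forall>x. x \<notin> {''lo'', ''hi'', ''mid''} \<longrightarrow> s' x = s x))"
proof -
  define fr where "fr s' \<longleftrightarrow> (\<forall>x. x \<notin> {''lo'', ''hi'', ''mid''} \<longrightarrow> s' x = s x)" for s' :: state
  have fr_upd: "fr (s'(x := f))" if "fr s'" "x \<in> {''lo'', ''hi'', ''mid''}" for s' x f
    using that by (auto simp: fr_def)
  \<comment> \<open>The bisection interval has length at most \<open>2 ^ k\<close>, so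
    \<open>k\<close> can start at \<open>w\<close> because \<open>n + 1 < 2 ^ w\<close>.\<close>
  define I where "I k s' \<longleftrightarrow> bounded w s' \<and> fr s' \<and>
    (\<exists>lo hi. s' ''lo'' 0 = int lo \<and> s' ''hi'' 0 = int hi \<and> lo * lo \<le> n \<and> n < hi * hi \<and>
      hi \<le> n + 1 \<and> lo < hi \<and> hi - lo \<le> 2 ^ k)" for k :: nat and s' :: state
  have n: "s' ''n'' 0 = int n" if "fr s'" for s' using that assms(2) by (auto simp: fr_def)
  have loop: "runs w (While (Less (Add (V ''lo'') (Num 1)) (V ''hi''))
           (Seq (Assign ''mid'' (Div (Add (V ''lo'') (V ''hi'')) (Num 2)))
                (Cond (Less (V ''n'') (Mul (V ''mid'') (V ''mid'')))
                  (Assign ''hi'' (V ''mid''))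
                  (Assign ''lo'' (V ''mid''))))) s' ((w + 1) * ((1 + (1 + 1)) + 1))
          (\<lambda>s'. bounded w s' \<and> s' ''lo'' 0 = int (floor_sqrt n) \<and> fr s')"
    if "I w s'" for s'
  proof (rule runs_While[where I = I, OF that])
    fix k s'
    assume I: "I k s'"
    then obtain lo hi where lh: "s' ''lo'' 0 = int lo" "s' ''hi'' 0 = int hi" "lo * lo \<le> n"
      "n < hi * hi" "hi \<le> n + 1" "lo < hi" "hi - lo \<le> 2 ^ k" and b: "bounded w s'" and f: "fr s'"
      by (auto simp: I_def)
    show "bounded w s'" by (rule b)
    {
      assume "bval (Less (Add (V ''lo'') (Num 1)) (V ''hi'')) s'"
      then have gap: "lo + 1 < hi" using lh by simp
      then have k: "k > 0" using lh(7) by (cases k) auto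
      define mid where "mid = (lo + hi) div 2"
      have mid: "lo < mid" "mid < hi" using gap by (auto simp: mid_def)
      have pw: "(2::nat) ^ k = 2 * 2 ^ (k - 1)" using k by (cases k) auto
      have half: "hi - mid \<le> 2 ^ (k - 1)" "mid - lo \<le> 2 ^ (k - 1)"
        using lh(7) gap unfolding pw mid_def by linarith+
      have val: "(int lo + int hi) div 2 = int mid" by (simp add: mid_def zdiv_int)
      have midw: "int mid < 2 ^ w" using mid lh assms(3) by linarith
      have "runs w (Seq (Assign ''mid'' (Div (Add (V ''lo'') (V ''hi'')) (Num 2)))
                (Cond (Less (V ''n'') (Mul (V ''mid'') (V ''mid'')))
                  (Assign ''hi'' (V ''mid''))
                  (Assign ''lo'' (V ''mid'')))) s' (1 + (1 + 1)) (I (k - 1))"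
      proof (rule runs_Seq, rule runs_Write[OF b], rule runs_Cond)
        let ?s = "s'(''mid'' := (s' ''mid'')(aval (Num 0) s' := aval (Div (Add (V ''lo'') (V ''hi'')) (Num 2)) s'))"
        show bs: "bounded w ?s"
          by (rule bounded_update[OF b]) (use midw in \<open>simp_all add: val lh boundedD[OF b]\<close>)
        have fs: "fr ?s" by (rule fr_upd[OF f]) simp
        have ms: "?s ''mid'' 0 = int mid" "?s ''lo'' 0 = int lo" "?s ''hi'' 0 = int hi"
          using lh val by simp_all
        show "runs w (Assign ''hi'' (V ''mid'')) ?s 1 (I (k - 1))"
          if "bval (Less (V ''n'') (Mul (V ''mid'') (V ''mid''))) ?s"
        proof (rule runs_Write[OF bs], unfold I_def, intro conjI)
          have "n < mid * mid" using that ms n[OF fs] by (simp flip: of_nat_mult)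
          then show "\<exists>lo' hi'. (?s(''hi'' := (?s ''hi'')(aval (Num 0) ?s := aval (V ''mid'') ?s))) ''lo'' 0 = int lo' \<and>
            (?s(''hi'' := (?s ''hi'')(aval (Num 0) ?s := aval (V ''mid'') ?s))) ''hi'' 0 = int hi' \<and>
            lo' * lo' \<le> n \<and> n < hi' * hi' \<and> hi' \<le> n + 1 \<and> lo' < hi' \<and> hi' - lo' \<le> 2 ^ (k - 1)"
            using ms mid half lh by (intro exI[of _ lo] exI[of _ mid]) auto
        qed (use bs fs ms midw in \<open>auto intro!: bounded_update fr_upd boundedD[OF b]\<close>)
        show "runs w (Assign ''lo'' (V ''mid'')) ?s 1 (I (k - 1))"
          if "\<not> bval (Less (V ''n'') (Mul (V ''mid'') (V ''mid''))) ?s"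
        proof (rule runs_Write[OF bs], unfold I_def, intro conjI)
          have "mid * mid \<le> n" using that ms n[OF fs] by (simp flip: of_nat_mult)
          then show "\<exists>lo' hi'. (?s(''lo'' := (?s ''lo'')(aval (Num 0) ?s := aval (V ''mid'') ?s))) ''lo'' 0 = int lo' \<and>
            (?s(''lo'' := (?s ''lo'')(aval (Num 0) ?s := aval (V ''mid'') ?s))) ''hi'' 0 = int hi' \<and>
            lo' * lo' \<le> n \<and> n < hi' * hi' \<and> hi' \<le> n + 1 \<and> lo' < hi' \<and> hi' - lo' \<le> 2 ^ (k - 1)"
            using ms mid half lh by (intro exI[of _ mid] exI[of _ hi]) auto
        qed (use bs fs ms midw in \<open>auto intro!: bounded_update fr_upd boundedD[OF b]\<close>)
      qed
      then show "k > 0 \<and> runs w (Seq (Assign ''mid'' (Div (Add (V ''lo'') (V ''hi'')) (Num 2)))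
                (Cond (Less (V ''n'') (Mul (V ''mid'') (V ''mid'')))
                  (Assign ''hi'' (V ''mid''))
                  (Assign ''lo'' (V ''mid'')))) s' (1 + (1 + 1)) (I (k - 1))"
        using k by blast
    }
    assume "\<not> bval (Less (Add (V ''lo'') (Num 1)) (V ''hi'')) s'"
    then have "hi = Suc lo" using lh by simp
    then have "floor_sqrt n = lo"
      using lh by (intro floor_sqrt_unique) (auto simp: power2_eq_square)
    then show "bounded w s' \<and> s' ''lo'' 0 = int (floor_sqrt n) \<and> fr s'" using b f lh by simp
  qed
  have "int (n + 1) < int (2 ^ w)" using assms(3) by simp
  then have nw: "n + 1 \<le> 2 ^ w" by (simp only: of_nat_less_iff less_imp_le)
  show ?thesis
    unfolding integer_sqrt_def fr_def[symmetric]
  proof (rule runs_Seq, rule runs_Write[OF assms(1)], rule runs_Seq, rule runs_Write)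
    let ?s1 = "s(''lo'' := (s ''lo'')(aval (Num 0) s := aval (Num 0) s))"
    show b1: "bounded w ?s1" by (rule bounded_update[OF assms(1)]) (simp_all add: boundedD[OF assms(1)])
    have f1: "fr ?s1" by (rule fr_upd) (auto simp: fr_def)
    let ?s2 = "?s1(''hi'' := (?s1 ''hi'')(aval (Num 0) ?s1 := aval (Add (V ''n'') (Num 1)) ?s1))"
    have "I w ?s2"
      unfolding I_def
    proof (intro conjI)
      show "bounded w ?s2" by (rule bounded_update[OF b1]) (use assms in \<open>simp_all add: boundedD[OF assms(1)]\<close>)
      show "fr ?s2" by (rule fr_upd[OF f1]) simp
    qed (rule exI[of _ 0], rule exI[of _ "n + 1"], use assms nw in auto)
    then show "runs w (While (Less (Add (V ''lo'') (Num 1)) (V ''hi''))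
           (Seq (Assign ''mid'' (Div (Add (V ''lo'') (V ''hi'')) (Num 2)))
                (Cond (Less (V ''n'') (Mul (V ''mid'') (V ''mid'')))
                  (Assign ''hi'' (V ''mid''))
                  (Assign ''lo'' (V ''mid''))))) ?s2 ((w + 1) * ((1 + (1 + 1)) + 1))
          (\<lambda>s'. bounded w s' \<and> s' ''lo'' 0 = int (floor_sqrt n) \<and> fr s')"
      by (rule loop)
  qed
qed

lemma mat_sum_list_outer_squares:
  assumes "set ls \<subseteq> carrier_vec m"
  shows "mat_sum_list m (map outer_square ls) =
    mat m m (\<lambda>(i, j). \<Sum>l\<leftarrow>ls. l $ i * (l $ j :: 'a::semiring_0))"
  using assms
proof (induction ls)
  case Nil
  show ?case by (intro eq_matI) (auto simp: mat_sum_list_def)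
next
  case (Cons l ls)
  then show ?case by (intro eq_matI) (auto simp: mat_sum_list_def outer_square_def)
qed

text \<open>\<open>2 ^ h\<close> bounds \<open>D\<close> and the Bareiss entries, so weights and
  roots stay within \<open>2 ^ (2 * h)\<close> and output numbers within \<open>2 ^ (3 * h)\<close>;
  \<open>w_ge\<close> leaves room for sums such as \<open>n + 1\<close>. The bounds on
  \<open>m * m * m\<close> and \<open>m * J * m\<close> let the loop counters fit into
  \<open>w\<close> bits, and \<open>J\<close> limits the squares per weight.\<close>

locale square_sum_run = pos_def_int m Z for m :: nat and Z :: "nat \<Rightarrow> nat \<Rightarrow> int" +
  fixes num den :: "nat \<Rightarrow> int" and D :: int and h w J :: nat
  assumes m_pos: "0 < m"
    and den_pos: "\<And>t. t < m * m \<Longrightarrow> 0 < den t"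
    and D_def: "D = (\<Prod>t<m * m. den t)"
    and Z_def: "\<And>i j. i < m \<Longrightarrow> j < m \<Longrightarrow> Z i j = D * (D div den (i * m + j)) * num (i * m + j)"
    and D_le: "D \<le> 2 ^ h"
    and bareiss_le: "\<And>k i j. k < m \<Longrightarrow> i < m \<Longrightarrow> j < m \<Longrightarrow> \<bar>bareiss Z k i j\<bar> \<le> 2 ^ h"
    and w_ge: "3 * h + 2 \<le> w"
    and cube_less: "int (m * m * m) < 2 ^ w"
    and count_less: "int (m * J * m) < 2 ^ w"
    and greedy_le: "\<And>n. n \<le> 2 ^ (2 * h) \<Longrightarrow> greedy_squares n \<le> J"
begin

lemma power_h_less: "(2::int) ^ (3 * h) + 1 < 2 ^ w"
proof -
  have "(1::int) \<le> 2 ^ (3 * h)" by simp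
  moreover have "(2::int) ^ (3 * h + 2) = 4 * 2 ^ (3 * h)" by (simp add: power_add)
  ultimately have "(2::int) ^ (3 * h) + 1 < 2 ^ (3 * h + 2)" by linarith
  also have "\<dots> \<le> 2 ^ w" using w_ge by (intro power_increasing) auto
  finally show ?thesis .
qed

lemma one_less_w: "(1::int) < 2 ^ w"
  using power_h_less one_le_power[of "2::int" "3 * h"] by linarith

lemma less_w: "c \<le> 3 * h \<Longrightarrow> \<bar>v\<bar> \<le> 2 ^ c \<Longrightarrow> \<bar>v :: int\<bar> < 2 ^ w"
  using power_h_less power_increasing[of c "3 * h" "2::int"] by linarith

lemma m_less_w: "int m < 2 ^ w" "int (m * m) < 2 ^ w"
proof -
  have "m \<le> m * m * m" "m * m \<le> m * m * m" using m_pos by auto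
  then show "int m < 2 ^ w" "int (m * m) < 2 ^ w"
    using cube_less by (meson le_less_trans of_nat_mono)+
qed

definition inputs :: "state \<Rightarrow> bool" where
  "inputs s \<longleftrightarrow> bounded w s \<and> s ''m'' 0 = int m \<and> s ''N'' 0 = 0 \<and>
     (\<forall>t<m * m. s ''num'' (int t) = num t \<and> s ''den'' (int t) = den t)"

lemma common_denominator_runs:
  assumes "inputs s" "s ''t'' 0 = 0"
  shows "runs w common_denominator s (1 + (m * m + 1) * ((1 + 1) + 1))
    (\<lambda>s'. inputs s' \<and> s' ''D'' 0 = D)"
proof -
  define I where "I t s' \<longleftrightarrow> inputs s' \<and> s' ''t'' 0 = int t \<and> s' ''D'' 0 = (\<Prod>i<t. den i)"
    for t and s' :: state
  have "bounded w s" using assms by (simp add: inputs_def)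
  note bd0 = boundedD[OF this]
  \<comment> \<open>All denominators are at least 1, so partial products never exceed
    \<open>D\<close>.\<close>
  have prod_less: "\<bar>\<Prod>i<t. den i\<bar> < 2 ^ w" if "t \<le> m * m" for t
  proof -
    have "(\<Prod>i<t. den i) \<le> D"
      unfolding D_def using that den_pos by (intro prod_mono2) (auto simp: less_imp_le int_one_le_iff_zero_less)
    moreover have "0 \<le> (\<Prod>i<t. den i)" using that den_pos by (intro prod_nonneg) (auto simp: less_imp_le)
    ultimately show ?thesis using D_le less_w[of h "\<Prod>i<t. den i"] by auto
  qed
  show ?thesis
    unfolding common_denominator_def
  proof (rule runs_Seq, rule runs_Write, goal_cases)
    case 1
    then show ?case using assms by (simp add: inputs_def)
  next
    case 2
    show ?case
    proof (rule runs_For[where I = I])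
      fix t s'
      assume I: "I t s'" and t: "t < m * m"
      then have b: "bounded w s'" by (simp add: I_def inputs_def)
      note bd = boundedD[OF b]
      have tw: "int t + 1 < 2 ^ w" using t m_less_w(2) by linarith
      have pt: "\<bar>(\<Prod>i<t. den i) * den t\<bar> < 2 ^ w" using prod_less[of "Suc t"] t by simp
      show "runs w (Seq (Assign ''D'' (Mul (V ''D'') (Read ''den'' (V ''t'')))) (Incr ''t'')) s'
          (1 + 1) (I (Suc t))"
      proof (rule runs_Seq, rule runs_Write[OF b], rule runs_Write, goal_cases)
        case 1
        then show ?case using I t pt b by (auto simp: I_def inputs_def intro!: bounded_update bd)
      next
        case 2
        then show ?case using I t pt b tw
          by (auto simp: I_def inputs_def intro!: bounded_update bd)
      qed
    qed (use assms m_less_w one_less_w in \<open>auto simp: I_def inputs_def D_def intro!: bounded_update bd0\<close>)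
  qed
qed

definition scaled :: "state \<Rightarrow> bool" where
  "scaled s \<longleftrightarrow> inputs s \<and> s ''D'' 0 = D \<and> (\<forall>t<m * m. s ''F'' (int t) = Z (t div m) (t mod m))"

lemma Z_abs_less: "i < m \<Longrightarrow> j < m \<Longrightarrow> \<bar>Z i j\<bar> < 2 ^ w"
  using bareiss_le[of 0 i j] m_pos by (intro less_w[of h]) (simp_all add: bareiss_0)

lemma clear_denominators_runs:
  assumes "inputs s" "s ''D'' 0 = D"
  shows "runs w clear_denominators s (1 + (m * m + 1) * ((1 + 1) + 1)) scaled"
proof -
  define I where "I t s' \<longleftrightarrow> inputs s' \<and> s' ''t'' 0 = int t \<and> s' ''D'' 0 = D \<and>
    (\<forall>t'<t. s' ''F'' (int t') = Z (t' div m) (t' mod m))"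
    for t and s' :: state
  have b0: "bounded w s" using assms by (simp add: inputs_def)
  note bd0 = boundedD[OF b0]
  show ?thesis
    unfolding clear_denominators_def
  proof (rule runs_Seq, rule runs_Write[OF b0], rule runs_For[where I = I])
    fix t s'
    assume I: "I t s'" and t: "t < m * m"
    then have b: "bounded w s'" by (simp add: I_def inputs_def)
    note bd = boundedD[OF b]
    have tw: "int t + 1 < 2 ^ w" using t m_less_w(2) by linarith
    have ij: "t div m < m" "t mod m < m" using t m_pos by (auto simp: less_mult_imp_div_less)
    have val: "D * (D div den t) * num t = Z (t div m) (t mod m)"
      using Z_def[OF ij] by simp
    show "runs w (Seq (Write ''F'' (V ''t'')
                  (Mul (Mul (V ''D'') (Div (V ''D'') (Read ''den'' (V ''t'')))) (Read ''num'' (V ''t''))))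
                (Incr ''t'')) s' (1 + 1) (I (Suc t))"
    proof (rule runs_Seq, rule runs_Write[OF b], rule runs_Write, goal_cases)
      case 1
      then show ?case using I t b Z_abs_less[OF ij] val
        by (auto simp: I_def inputs_def intro!: bounded_update bd)
    next
      case 2
      then show ?case using I t b Z_abs_less[OF ij] val tw
        by (auto simp: I_def inputs_def less_Suc_eq intro!: bounded_update bd)
    qed
  qed (use assms in \<open>auto simp: I_def inputs_def scaled_def intro!: bounded_update bd0\<close>)
qed

definition eliminated :: "state \<Rightarrow> bool" where
  "eliminated s \<longleftrightarrow> bounded w s \<and> s ''m'' 0 = int m \<and> s ''D'' 0 = D \<and>
     s ''F'' (- (int m * int m + (int m + 1))) = 1 \<and>
     (\<forall>k<m. \<forall>i<m. \<forall>j<m. s ''F'' (int ((k * m + i) * m + j)) = bareiss Z k i j)"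

lemma diag_position: "int k * (int m * int m + (int m + 1)) = int ((k * m + k) * m + k)"
  by (simp add: algebra_simps)

text \<open>At \<open>k = 0\<close> the address is the negative cell holding 1, so one expression
  reads the divisor of every step without a case distinction in the program.\<close>

lemma read_pivot:
  assumes "f (- (int m * int m + (int m + 1))) = 1"
    and "k > 0 \<Longrightarrow> f (int (((k - 1) * m + (k - 1)) * m + (k - 1))) = bareiss Z (k - 1) (k - 1) (k - 1)"
  shows "f ((int k - 1) * (int m * int m + (int m + 1))) = bareiss_pivot Z k"
proof (cases "k = 0")
  case True
  then show ?thesis using assms(1) by (simp add: bareiss_pivot_def)
next
  case False
  then have "int k - 1 = int (k - 1)" by simp
  then show ?thesis using assms(2) False by (simp only: diag_position bareiss_pivot_def) simp
qed

text \<open>\<open>j\<close> and \<open>i\<close> are the two lowest base-\<open>m\<close> digits of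
  the address. Injectivity ensures that writing one cell of a new layer leaves all other entries
  intact.\<close>

lemma position_inj:
  assumes "(k * m + i) * m + j = (k' * m + i') * m + j'" "i < m" "j < m" "i' < m" "j' < m"
  shows "k = k' \<and> i = i' \<and> j = j'"
proof -
  have dm: "(a * m + c) mod m = c" "(a * m + c) div m = a" if "c < m" for a c :: nat
    using that by simp_all
  have "j = j'" using dm(1)[of j "k * m + i"] dm(1)[of j' "k' * m + i'"] assms by metis
  moreover have e: "k * m + i = k' * m + i'"
    using dm(2)[of j "k * m + i"] dm(2)[of j' "k' * m + i'"] assms by metis
  moreover have "i = i'" using dm(1)[of i k] dm(1)[of i' k'] assms e by metis
  moreover have "k = k'" using dm(2)[of i k] dm(2)[of i' k'] assms e by metis
  ultimately show ?thesis by simp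
qed

lemma position_less: "i < m \<Longrightarrow> j < m \<Longrightarrow> (k * m + i) * m + j < k * m * m + m * m"
proof -
  assume "i < m" "j < m"
  then have "i * m + j < Suc i * m" "Suc i * m \<le> m * m" by (simp, intro mult_right_mono, auto)
  then show ?thesis by (simp add: algebra_simps)
qed

lemma eliminate_runs:
  assumes "scaled s"
  shows "runs w eliminate s (1 + (1 + ((m - 1) * m * m + 1) * ((1 + (1 + (1 + 1))) + 1)))
    (\<lambda>s'. eliminated s' \<and> s' ''N'' 0 = 0)"
proof -
  \<comment> \<open>The invariant covers all addresses below \<open>t + m * m\<close>: initially
    exactly layer 0, and in each round everything the update reads apart from the initial
    divisor.\<close>
  define I where "I t s' \<longleftrightarrow> bounded w s' \<and> s' ''m'' 0 = int m \<and> s' ''D'' 0 = D \<and> s' ''N'' 0 = 0 \<and>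
    s' ''F'' (- (int m * int m + (int m + 1))) = 1 \<and> s' ''t'' 0 = int t \<and>
    (\<forall>k i j. i < m \<longrightarrow> j < m \<longrightarrow> (k * m + i) * m + j < t + m * m \<longrightarrow>
      s' ''F'' (int ((k * m + i) * m + j)) = bareiss Z k i j)"
    for t and s' :: state
  have b0: "bounded w s" using assms by (simp add: scaled_def inputs_def)
  note bd0 = boundedD[OF b0]
  have tbound: "int t + 1 < 2 ^ w" if "t < (m - 1) * m * m" for t
  proof -
    have "(m - 1) * m * m \<le> m * m * m" by (intro mult_right_mono) auto
    then show ?thesis using that cube_less by linarith
  qed
  have init: "I 0 s'" if s': "s' = s(''F'' := (s ''F'')(- (int m * int m + (int m + 1)) := 1),
      ''t'' := (s ''t'')(0 := 0))" for s'
    unfolding I_def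
  proof (intro conjI allI impI)
    show "bounded w s'" using one_less_w unfolding s'
      by (auto intro!: bounded_update b0 bd0)
    fix k i j assume ij: "i < m" "j < m" and less: "(k * m + i) * m + j < 0 + m * m"
    have "k = 0"
    proof (rule ccontr)
      assume "k \<noteq> 0"
      then have "1 * (m * m) \<le> k * (m * m)" by (intro mult_right_mono) auto
      moreover have "(k * m + i) * m + j = k * (m * m) + i * m + j" by (simp add: algebra_simps)
      ultimately show False using less by linarith
    qed
    moreover have "int ((k * m + i) * m + j) \<noteq> - (int m * int m + (int m + 1))"
      by (smt (verit) of_nat_0_le_iff mult_nonneg_nonneg)
    ultimately show "s' ''F'' (int ((k * m + i) * m + j)) = bareiss Z k i j"
      using assms less ij by (simp add: s' scaled_def bareiss_0 del: of_nat_add of_nat_mult)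
  qed (use assms in \<open>auto simp: s' scaled_def inputs_def\<close>)
  have body: "runs w (Seq (Assign ''k'' (Div (V ''t'') (Mul (V ''m'') (V ''m''))))
           (Seq (Assign ''j'' (Sub (V ''t'') (Mul (V ''m'') (Div (V ''t'') (V ''m'')))))
           (Seq (Write ''F'' (Add (V ''t'') (Mul (V ''m'') (V ''m'')))
                  (Div (Sub (Mul (Read ''F'' (diag_index (V ''k''))) (Read ''F'' (V ''t'')))
                            (Mul (Read ''F'' (Add (Sub (V ''t'') (V ''j'')) (V ''k'')))
                                 (Read ''F'' (Add (Mul (Mul (V ''k'') (Add (V ''m'') (Num 1))) (V ''m''))
                                                  (V ''j'')))))
                       (Read ''F'' (diag_index (Sub (V ''k'') (Num 1))))))
                (Incr ''t'')))) s' (1 + (1 + (1 + 1))) (I (Suc t))"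
    if I: "I t s'" and t: "t < (m - 1) * m * m" for t s'
  proof -
    have b: "bounded w s'" using I by (simp add: I_def)
    note bd = boundedD[OF b]
    define k i j where "k = t div (m * m)" and "i = t div m mod m" and "j = t mod m"
    have ij: "i < m" "j < m" using m_pos by (auto simp: i_def j_def)
    have tk: "t = (k * m + i) * m + j"
      by (simp add: k_def i_def j_def div_mult2_eq)
    have km: "k * m * m \<le> t" by (simp add: tk algebra_simps)
    \<comment> \<open>The cell to be written lies in layer \<open>k + 1\<close>, which must be below
      \<open>m\<close> for \<open>bareiss_le\<close> to bound its value.\<close>
    have "k < m - 1"
    proof (rule ccontr)
      assume "\<not> k < m - 1"
      then have "(m - 1) * m * m \<le> k * m * m" by (intro mult_right_mono) auto
      then show False using km t by linarith
    qed
    then have k: "Suc k < m" by simp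
    have F: "s' ''F'' (int ((k' * m + a) * m + c)) = bareiss Z k' a c"
      if "k' \<le> k" "a < m" "c < m" for k' a c
    proof -
      have "k' * m * m \<le> k * m * m" using that by (intro mult_right_mono) auto
      then have "(k' * m + a) * m + c < t + m * m" using position_less[of a c k'] that km by linarith
      then show ?thesis using I that unfolding I_def by blast
    qed
    have kv: "int t div (int m * int m) = int k" by (simp add: k_def zdiv_int)
    have jv: "int t - int m * (int t div int m) = int j"
      by (simp add: j_def minus_mult_div_eq_mod zmod_int)
    have kw: "\<bar>int k\<bar> < 2 ^ w" "\<bar>int j\<bar> < 2 ^ w" using k ij m_less_w(1) by auto
    define s2 where "s2 = s'(''k'' := (s' ''k'')(0 := int k), ''j'' := (s' ''j'')(0 := int j))"
    have b2: "bounded w s2" unfolding s2_def using kw by (auto intro!: bounded_update b bd)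
    define s3 where "s3 = s2(''F'' := (s2 ''F'')(int ((Suc k * m + i) * m + j) := bareiss Z (Suc k) i j))"
    have vw: "\<bar>bareiss Z (Suc k) i j\<bar> < 2 ^ w"
      using bareiss_le[OF k ij] by (intro less_w[of h]) auto
    have b3: "bounded w s3" unfolding s3_def
      by (rule bounded_update[OF b2 _ vw]) (simp add: s2_def bd)
    have s2v: "s2 ''m'' 0 = int m" "s2 ''t'' 0 = int t" "s2 ''k'' 0 = int k" "s2 ''j'' 0 = int j"
      "s2 ''F'' = s' ''F''"
      using I by (auto simp: s2_def I_def)
    have pv: "s' ''F'' ((int k - 1) * (int m * int m + (int m + 1))) = bareiss_pivot Z k"
    proof (rule read_pivot)
      show "s' ''F'' (- (int m * int m + (int m + 1))) = 1" using I unfolding I_def by blast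
      show "s' ''F'' (int (((k - 1) * m + (k - 1)) * m + (k - 1))) = bareiss Z (k - 1) (k - 1) (k - 1)"
        by (rule F) (use k in auto)
    qed
    have dv: "s' ''F'' (int k * (int m * int m + (int m + 1))) = bareiss Z k k k"
      using F[of k k k] k by (simp only: diag_position)
    have tv: "s' ''F'' (int t) = bareiss Z k i j" using F[of k i j] ij by (simp add: tk)
    have cv: "s' ''F'' (int t - int j + int k) = bareiss Z k i k"
    proof -
      have "int t - int j + int k = int ((k * m + i) * m + k)" by (simp add: tk)
      then show ?thesis using F[of k i k] ij k by simp
    qed
    have rv: "s' ''F'' (int k * (int m + 1) * int m + int j) = bareiss Z k k j"
    proof -
      have "int k * (int m + 1) * int m + int j = int ((k * m + k) * m + j)"
        by (simp add: algebra_simps)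
      then show ?thesis using F[of k k j] ij k by simp
    qed
    have pos: "int t + int m * int m = int ((Suc k * m + i) * m + j)"
      by (simp add: tk algebra_simps)
    show ?thesis
    proof (rule runs_Seq, rule runs_Write[OF b], rule runs_Seq, rule runs_Write, goal_cases)
      case 1
      show ?case using I kv kw by (auto simp: I_def intro!: bounded_update b bd)
    next
      case 2
      have eq: "s'(''k'' := (s' ''k'')(aval (Num 0) s' := aval (Div (V ''t'') (Mul (V ''m'') (V ''m''))) s'),
          ''j'' := ((s'(''k'' := (s' ''k'')(aval (Num 0) s' := aval (Div (V ''t'') (Mul (V ''m'') (V ''m''))) s')))
            ''j'')(aval (Num 0) (s'(''k'' := (s' ''k'')(aval (Num 0) s' := aval (Div (V ''t'') (Mul (V ''m'') (V ''m''))) s')))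
            := aval (Sub (V ''t'') (Mul (V ''m'') (Div (V ''t'') (V ''m''))))
              (s'(''k'' := (s' ''k'')(aval (Num 0) s' := aval (Div (V ''t'') (Mul (V ''m'') (V ''m''))) s')))))
          = s2"
        using I kv jv by (simp add: I_def s2_def)
      show ?case
        unfolding eq
      \<comment> \<open>Rewriting the five reads by their Bareiss values leaves the right-hand side
        of the recurrence, which is then folded into the new entry.\<close>
      proof (rule runs_Seq, rule runs_Write[OF b2], unfold aval.simps diag_index_def s2v dv tv cv rv pv pos
          bareiss_Suc[OF Suc_lessD[OF k], symmetric] s3_def[unfolded s2v, symmetric],
          rule runs_Write[OF b3])
        have t3: "s3 ''t'' 0 = int t" by (simp add: s3_def s2v)
        show "I (Suc t) (s3(''t'' := (s3 ''t'')(aval (Num 0) s3 := aval (Add (V ''t'') (Num 1)) s3)))"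
          unfolding I_def
        proof (intro conjI allI impI)
          show "bounded w (s3(''t'' := (s3 ''t'')(aval (Num 0) s3 := aval (Add (V ''t'') (Num 1)) s3)))"
            by (rule bounded_update[OF b3 boundedD[OF b3, of "''t''"]]) (use t3 tbound[OF t] in simp)
          fix k' i' j'
          assume ij': "i' < m" "j' < m" and less: "(k' * m + i') * m + j' < Suc t + m * m"
          show "(s3(''t'' := (s3 ''t'')(aval (Num 0) s3 := aval (Add (V ''t'') (Num 1)) s3))) ''F''
             (int ((k' * m + i') * m + j')) = bareiss Z k' i' j'"
          proof (cases "(k' * m + i') * m + j' = (Suc k * m + i) * m + j")
            case True
            then show ?thesis using position_inj[OF True ij' ij]
              by (simp add: s3_def s2v del: of_nat_add of_nat_mult)
          next
            case False
            have "t + m * m = (Suc k * m + i) * m + j" by (simp add: tk algebra_simps)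
            then have "(k' * m + i') * m + j' < t + m * m" using False less by linarith
            then have "s' ''F'' (int ((k' * m + i') * m + j')) = bareiss Z k' i' j'"
              using I ij' unfolding I_def by blast
            moreover have "int ((k' * m + i') * m + j') \<noteq> int ((Suc k * m + i) * m + j)"
              using False by (simp only: of_nat_eq_iff not_False_eq_True)
            ultimately show ?thesis by (simp add: s3_def s2v del: of_nat_add of_nat_mult)
          qed
        next
          have "- (int m * int m + (int m + 1)) \<noteq> int ((Suc k * m + i) * m + j)"
            by (smt (verit) of_nat_0_le_iff mult_nonneg_nonneg)
          then show "(s3(''t'' := (s3 ''t'')(aval (Num 0) s3 := aval (Add (V ''t'') (Num 1)) s3))) ''F''
             (- (int m * int m + (int m + 1))) = 1"
            using I by (simp add: s3_def s2v I_def del: of_nat_add of_nat_mult)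
        qed (use I in \<open>auto simp: s3_def s2_def I_def\<close>)
      qed
    qed
  qed
  have exit: "eliminated s' \<and> s' ''N'' 0 = 0" if "I ((m - 1) * m * m) s'" for s'
  proof -
    have "s' ''F'' (int ((k * m + i) * m + j)) = bareiss Z k i j" if "k < m" "i < m" "j < m" for k i j
    proof -
      have "k * m * m \<le> (m - 1) * m * m" using that by (intro mult_right_mono) auto
      then have "(k * m + i) * m + j < (m - 1) * m * m + m * m"
        using position_less[of i j k] that by linarith
      then show ?thesis using \<open>I _ s'\<close> that unfolding I_def by blast
    qed
    then show ?thesis using that by (simp add: eliminated_def I_def)
  qed
  show ?thesis
    unfolding eliminate_def
  proof (rule runs_Seq, rule runs_Write[OF b0], rule runs_Seq, rule runs_Write, goal_cases)
    case 1
    show ?case using one_less_w by (auto intro!: bounded_update b0 bd0)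
  next
    case 2
    show ?case
    proof (rule runs_For[where I = I], goal_cases)
      case 1
      show ?case by (rule init) (use assms in \<open>simp add: scaled_def inputs_def diag_index_def\<close>)
    next
      case (2 t s')
      then show ?case using m_pos by (simp add: I_def of_nat_diff)
    next
      case (3 t s')
      then show ?case by (rule body)
    next
      case (4 s')
      then show ?case by (rule exit)
    qed
  qed
qed

definition weight :: "nat \<Rightarrow> nat" where
  "weight k = nat (bareiss_pivot Z k * bareiss_pivot Z (Suc k))"

lemma bareiss_pivot_le: "k \<le> m \<Longrightarrow> bareiss_pivot Z k \<le> 2 ^ h"
  using bareiss_le[of "k - 1" "k - 1" "k - 1"] by (cases k) (auto simp: bareiss_pivot_def)

lemma int_weight: "k < m \<Longrightarrow> int (weight k) = bareiss_pivot Z k * bareiss_pivot Z (Suc k)"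
  using bareiss_pivot_pos[of k] bareiss_pivot_pos[of "Suc k"] by (simp add: weight_def)

lemma weight_pos: "k < m \<Longrightarrow> 0 < weight k"
  using bareiss_pivot_pos[of k] bareiss_pivot_pos[of "Suc k"] by (simp add: weight_def)

lemma weight_le: "k < m \<Longrightarrow> weight k \<le> 2 ^ (2 * h)"
proof -
  assume k: "k < m"
  have "bareiss_pivot Z k * bareiss_pivot Z (Suc k) \<le> 2 ^ h * 2 ^ h"
    using k bareiss_pivot_pos[of k] bareiss_pivot_pos[of "Suc k"]
    by (intro mult_mono bareiss_pivot_le) auto
  then have "int (weight k) \<le> int (2 ^ (2 * h))"
    using int_weight[OF k] by (simp add: mult_2 power_add)
  then show ?thesis by (simp only: of_nat_le_iff)
qed

lemma weight_less_w: "k < m \<Longrightarrow> n \<le> weight k \<Longrightarrow> int n + 1 < 2 ^ w"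
proof -
  assume "k < m" "n \<le> weight k"
  then have "int n \<le> int (2 ^ (2 * h))" unfolding of_nat_le_iff using weight_le[of k] by linarith
  also have "\<dots> \<le> 2 ^ (3 * h)" by (simp add: power_increasing)
  finally show ?thesis using power_h_less by linarith
qed

lemma pivot_product_value:
  assumes "eliminated s" "s ''k'' 0 = int k" "k < m"
  shows "aval pivot_product s = int (weight k)"
proof -
  have F: "s ''F'' (int ((k' * m + i) * m + j)) = bareiss Z k' i j" if "k' < m" "i < m" "j < m" for k' i j
    using assms(1) that unfolding eliminated_def by blast
  have "s ''F'' (int k * (int m * int m + (int m + 1))) = bareiss Z k k k"
    unfolding diag_position by (rule F) (use assms in auto)
  moreover have "s ''F'' ((int k - 1) * (int m * int m + (int m + 1))) = bareiss_pivot Z k"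
  proof (rule read_pivot)
    show "s ''F'' (- (int m * int m + (int m + 1))) = 1" using assms unfolding eliminated_def by blast
    show "s ''F'' (int (((k - 1) * m + (k - 1)) * m + (k - 1))) = bareiss Z (k - 1) (k - 1) (k - 1)"
      by (rule F) (use assms in auto)
  qed
  moreover have "s ''m'' 0 = int m" using assms by (simp add: eliminated_def)
  ultimately show ?thesis
    unfolding pivot_product_def diag_index_def aval.simps assms(2) int_weight[OF assms(3)]
    by (simp add: bareiss_pivot_def)
qed

lemma eliminated_cong:
  assumes "eliminated s" "bounded w s'" "s' ''m'' = s ''m''" "s' ''D'' = s ''D''" "s' ''F'' = s ''F''"
  shows "eliminated s'"
  using assms unfolding eliminated_def by simp

text \<open>The squares found so far are recorded through all their weighted sums \<open>X c\<close>: the weight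
  \<open>c k\<close> will be an entry of the rank-one matrix belonging to the \<open>k\<close>-th pivot.\<close>

definition recorded :: "state \<Rightarrow> nat \<Rightarrow> ((nat \<Rightarrow> rat) \<Rightarrow> rat) \<Rightarrow> bool" where
  "recorded s N X \<longleftrightarrow>
     s ''N'' 0 = int N \<and>
     (\<forall>q<N. 0 \<le> s ''R'' (int q) \<and> s ''R'' (int q) \<le> 2 ^ (2 * h) \<and>
        0 \<le> s ''K'' (int q) \<and> s ''K'' (int q) < int m) \<and>
     (\<forall>c. (\<Sum>q<N. (of_int (s ''R'' (int q)))\<^sup>2 * c (nat (s ''K'' (int q)))) = X c)"

lemma split_squares_runs:
  assumes el: "eliminated s" and rc: "recorded s N X" and k: "k < m"
    and "s ''k'' 0 = int k" "s ''n'' 0 = int (weight k)" "N \<le> k * J"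
  shows "runs w split_squares s
    ((J + 1) * (((1 + (1 + (w + 1) * ((1 + (1 + 1)) + 1))) + (1 + (1 + (1 + 1)))) + 1))
    (\<lambda>s'. eliminated s' \<and> s' ''k'' 0 = int k \<and>
      (\<exists>N'. N < N' \<and> N' \<le> N + J \<and> recorded s' N' (\<lambda>c. X c + of_nat (weight k) * c k)))"
proof -
  \<comment> \<open>Squares stored plus squares still to come is constant, which determines
    \<open>N'\<close> at the exit. The part of the weight already represented is
    \<open>weight k - n\<close>.\<close>
  define I where "I g s' \<longleftrightarrow> (\<exists>n N'. eliminated s' \<and> s' ''k'' 0 = int k \<and> s' ''n'' 0 = int n \<and>
      g = greedy_squares n \<and> n \<le> weight k \<and> N' + g = N + greedy_squares (weight k) \<and>
      recorded s' N' (\<lambda>c. X c + of_nat (weight k - n) * c k))" for g and s' :: state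
  have gJ: "greedy_squares (weight k) \<le> J" by (rule greedy_le[OF weight_le[OF k]])
  \<comment> \<open>A positive weight needs at least one square; over all pivots this yields
    \<open>m \<le> N\<close>.\<close>
  have gpos: "0 < greedy_squares (weight k)"
    using greedy_squares_step[OF weight_pos[OF k]] by simp
  have Nw: "int (N' + 1) < 2 ^ w" if "N' < N + greedy_squares (weight k)" for N'
  proof -
    have "N' + 1 \<le> k * J + J" using that gJ assms by linarith
    also have "\<dots> = Suc k * J" by simp
    also have "\<dots> \<le> m * J" using k by (intro mult_right_mono) auto
    also have "\<dots> \<le> m * J * m" using m_pos by simp
    finally show ?thesis using count_less by linarith
  qed
  have "runs w split_squares s
    ((greedy_squares (weight k) + 1) * (((1 + (1 + (w + 1) * ((1 + (1 + 1)) + 1))) + (1 + (1 + (1 + 1)))) + 1))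
    (\<lambda>s'. eliminated s' \<and> s' ''k'' 0 = int k \<and>
      (\<exists>N'. N < N' \<and> N' \<le> N + J \<and> recorded s' N' (\<lambda>c. X c + of_nat (weight k) * c k)))"
    unfolding split_squares_def
  proof (rule runs_While[where I = I])
    show "I (greedy_squares (weight k)) s"
      unfolding I_def by (rule exI[of _ "weight k"], rule exI[of _ N]) (use assms in simp)
  next
    fix g s'
    assume "I g s'"
    then obtain n N' where el': "eliminated s'" and s': "s' ''k'' 0 = int k" "s' ''n'' 0 = int n"
      and g: "g = greedy_squares n" "N' + g = N + greedy_squares (weight k)"
      and n: "n \<le> weight k" and rc': "recorded s' N' (\<lambda>c. X c + of_nat (weight k - n) * c k)"
      by (auto simp: I_def)
    show b: "bounded w s'" using el' by (simp add: eliminated_def)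
    {
      assume "\<not> bval (Less (Num 0) (V ''n'')) s'"
      then have "n = 0" using s' by simp
      then show "eliminated s' \<and> s' ''k'' 0 = int k \<and>
          (\<exists>N'. N < N' \<and> N' \<le> N + J \<and> recorded s' N' (\<lambda>c. X c + of_nat (weight k) * c k))"
        using el' s' rc' g gJ gpos by (intro conjI exI[of _ N']) auto
    next
      assume "bval (Less (Num 0) (V ''n'')) s'"
      then have n0: "0 < n" using s' by simp
      define r where "r = floor_sqrt n"
      have r2: "r * r \<le> n" using floor_sqrt_power2_le[of n] by (simp add: r_def power2_eq_square)
      have g': "g = Suc (greedy_squares (n - r * r))"
        using greedy_squares_step[OF n0] g(1) by (simp add: r_def power2_eq_square)
      have N'w: "int (N' + 1) < 2 ^ w" using g(2) g' by (intro Nw) linarith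
      have rn: "r \<le> n" using floor_sqrt_le[of n] by (simp add: r_def)
      have nw: "int n + 1 < 2 ^ w" by (rule weight_less_w[OF k n])
      have "runs w (Seq integer_sqrt
       (Seq (Write ''R'' (V ''N'') (V ''lo''))
       (Seq (Write ''K'' (V ''N'') (V ''k''))
       (Seq (Assign ''n'' (Sub (V ''n'') (Mul (V ''lo'') (V ''lo''))))
            (Incr ''N''))))) s' ((1 + (1 + (w + 1) * ((1 + (1 + 1)) + 1))) + (1 + (1 + (1 + 1)))) (I (g - 1))"
      proof (rule runs_Seq, rule runs_mono[OF integer_sqrt_runs[OF b s'(2) nw] order_refl])
        fix s1
        assume s1: "bounded w s1 \<and> s1 ''lo'' 0 = int (floor_sqrt n) \<and>
          (\<forall>x. x \<notin> {''lo'', ''hi'', ''mid''} \<longrightarrow> s1 x = s' x)"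
        then have b1: "bounded w s1" by blast
        note bd1 = boundedD[OF b1]
        have v1: "s1 ''lo'' 0 = int r" "s1 ''n'' 0 = int n" "s1 ''k'' 0 = int k" "s1 ''N'' 0 = int N'"
          "s1 ''m'' = s' ''m''" "s1 ''D'' = s' ''D''" "s1 ''F'' = s' ''F''" "s1 ''R'' = s' ''R''" "s1 ''K'' = s' ''K''"
          using s1 s' rc' by (auto simp: r_def recorded_def)
        have el1: "eliminated s1" by (rule eliminated_cong[OF el' b1]) (use v1 in auto)
        define s2 where "s2 = s1(''R'' := (s1 ''R'')(int N' := int r))"
        define s3 where "s3 = s2(''K'' := (s2 ''K'')(int N' := int k))"
        define s4 where "s4 = s3(''n'' := (s3 ''n'')(0 := int (n - r * r)))"
        define s5 where "s5 = s4(''N'' := (s4 ''N'')(0 := int (N' + 1)))"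
        have less: "\<bar>int r\<bar> < 2 ^ w" "\<bar>int k\<bar> < 2 ^ w" "\<bar>int (n - r * r)\<bar> < 2 ^ w" "\<bar>int (N' + 1)\<bar> < 2 ^ w"
          using rn nw k m_less_w N'w by linarith+
        have b2: "bounded w s2" unfolding s2_def
          by (rule bounded_update[OF b1 bd1 less(1)])
        have b3: "bounded w s3" unfolding s3_def
          by (rule bounded_update[OF b2 boundedD[OF b2] less(2)])
        have b4: "bounded w s4" unfolding s4_def
          by (rule bounded_update[OF b3 boundedD[OF b3] less(3)])
        have b5: "bounded w s5" unfolding s5_def
          by (rule bounded_update[OF b4 boundedD[OF b4] less(4)])
        have v: "s1 ''N'' 0 = int N'" "s2 ''N'' 0 = int N'" "s4 ''N'' 0 = int N'"
          "s2 ''k'' 0 = int k" "s3 ''n'' 0 = int n" "s3 ''lo'' 0 = int r" "s1 ''lo'' 0 = int r"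
          using v1 by (simp_all add: s2_def s3_def s4_def)
        have nv: "int n - int r * int r = int (n - r * r)" using r2 by (simp add: of_nat_diff)
        have Nv: "int N' + 1 = int (N' + 1)" by simp
        have "I (g - 1) s5"
          unfolding I_def
        proof (rule exI[of _ "n - r * r"], rule exI[of _ "N' + 1"], intro conjI)
          show "eliminated s5"
            by (rule eliminated_cong[OF el1 b5]) (simp_all add: s2_def s3_def s4_def s5_def)
          show "recorded s5 (N' + 1) (\<lambda>c. X c + of_nat (weight k - (n - r * r)) * c k)"
            unfolding recorded_def
          proof (intro conjI allI impI)
            fix c :: "nat \<Rightarrow> rat"
            have "(\<Sum>q<N'. (of_int (s5 ''R'' (int q)))\<^sup>2 * c (nat (s5 ''K'' (int q)))) =
               X c + of_nat (weight k - n) * c k"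
              using rc' v1 by (simp add: recorded_def s2_def s3_def s4_def s5_def)
            moreover have "s5 ''R'' (int N') = int r" "s5 ''K'' (int N') = int k"
              by (simp_all add: s2_def s3_def s4_def s5_def)
            moreover have "weight k - (n - r * r) = (weight k - n) + r * r" using r2 n by linarith
            ultimately show "(\<Sum>q<N' + 1. (of_int (s5 ''R'' (int q)))\<^sup>2 * c (nat (s5 ''K'' (int q)))) =
               X c + of_nat (weight k - (n - r * r)) * c k"
              by (simp add: power2_eq_square distrib_right)
          next
            have rle: "int r \<le> 2 ^ (2 * h)"
            proof -
              have "r \<le> 2 ^ (2 * h)" using rn n weight_le[OF k] by linarith
              then show ?thesis by simp
            qed
            fix q assume q: "q < N' + 1"
            show "0 \<le> s5 ''R'' (int q)" "s5 ''R'' (int q) \<le> 2 ^ (2 * h)"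
              "0 \<le> s5 ''K'' (int q)" "s5 ''K'' (int q) < int m"
              using q rc' v1 k rle by (auto simp: recorded_def s2_def s3_def s4_def s5_def less_Suc_eq)
          qed (simp add: s5_def)
        qed (use g g' n v1 in \<open>auto simp: s2_def s3_def s4_def s5_def\<close>)
        then show "runs w (Seq (Write ''R'' (V ''N'') (V ''lo''))
             (Seq (Write ''K'' (V ''N'') (V ''k''))
             (Seq (Assign ''n'' (Sub (V ''n'') (Mul (V ''lo'') (V ''lo''))))
                  (Incr ''N'')))) s1 (1 + (1 + (1 + 1))) (I (g - 1))"
          \<comment> \<open>Each write alternates with evaluation at known cell values and folding
            of the new state, so that the state terms do not grow.\<close>
          by (intro runs_Seq runs_Write b1, unfold aval.simps v s2_def[symmetric],
              intro runs_Seq runs_Write b2, unfold aval.simps v s3_def[symmetric],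
              intro runs_Seq runs_Write b3, unfold aval.simps v nv s4_def[symmetric],
              intro runs_Write b4, unfold aval.simps v Nv s5_def[symmetric])
      qed
      then show "0 < g \<and> runs w (Seq integer_sqrt
       (Seq (Write ''R'' (V ''N'') (V ''lo''))
       (Seq (Write ''K'' (V ''N'') (V ''k''))
       (Seq (Assign ''n'' (Sub (V ''n'') (Mul (V ''lo'') (V ''lo''))))
            (Incr ''N''))))) s' ((1 + (1 + (w + 1) * ((1 + (1 + 1)) + 1))) + (1 + (1 + (1 + 1)))) (I (g - 1))"
        using g' by simp
    }
  qed
  then show ?thesis by (rule runs_mono) (use gJ in \<open>simp_all del: mult_Suc mult_Suc_right\<close>)
qed

lemma split_pivots_runs:
  assumes el: "eliminated s" and "s ''N'' 0 = 0"
  shows "runs w split_pivots s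
    (1 + (m + 1) * ((1 + ((J + 1) * (((1 + (1 + (w + 1) * ((1 + (1 + 1)) + 1))) + (1 + (1 + (1 + 1)))) + 1) + 1)) + 1))
    (\<lambda>s'. eliminated s' \<and> (\<exists>N. m \<le> N \<and> N \<le> m * J \<and>
      recorded s' N (\<lambda>c. \<Sum>k<m. of_nat (weight k) * c k)))"
proof -
  define I where "I k s' \<longleftrightarrow> eliminated s' \<and> s' ''k'' 0 = int k \<and> (\<exists>N. k \<le> N \<and> N \<le> k * J \<and>
      recorded s' N (\<lambda>c. \<Sum>l<k. of_nat (weight l) * c l))" for k and s' :: state
  have b: "bounded w s" using el by (simp add: eliminated_def)
  show ?thesis
    unfolding split_pivots_def
  proof (rule runs_Seq, rule runs_Write[OF b], rule runs_For[where I = I], goal_cases)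
    case 1
    let ?s = "s(''k'' := (s ''k'')(aval (Num 0) s := aval (Num 0) s))"
    have "bounded w ?s" by (rule bounded_update[OF b boundedD[OF b]]) simp
    then have "eliminated ?s" by (rule eliminated_cong[OF el]) simp_all
    then show ?case unfolding I_def using assms by (auto simp: recorded_def)
  next
    case (2 t s')
    then show ?case by (simp add: I_def eliminated_def)
  next
    case (3 k s')
    then obtain N where el': "eliminated s'" and kv: "s' ''k'' 0 = int k" and N: "k \<le> N" "N \<le> k * J"
      and rc: "recorded s' N (\<lambda>c. \<Sum>l<k. of_nat (weight l) * c l)" by (auto simp: I_def)
    have b': "bounded w s'" using el' by (simp add: eliminated_def)
    define s1 where "s1 = s'(''n'' := (s' ''n'')(0 := int (weight k)))"
    have b1: "bounded w s1" unfolding s1_def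
      by (rule bounded_update[OF b' boundedD[OF b']]) (use weight_less_w[OF 3(2) order_refl] in linarith)
    have el1: "eliminated s1" by (rule eliminated_cong[OF el' b1]) (simp_all add: s1_def)
    have rc1: "recorded s1 N (\<lambda>c. \<Sum>l<k. of_nat (weight l) * c l)"
      using rc by (simp add: recorded_def s1_def)
    have v1: "s1 ''k'' 0 = int k" "s1 ''n'' 0 = int (weight k)" using kv by (simp_all add: s1_def)
    show ?case
    proof (rule runs_Seq, rule runs_Write[OF b'], unfold pivot_product_value[OF el' kv 3(2)] aval.simps
        s1_def[symmetric], rule runs_Seq, rule runs_mono[OF split_squares_runs[OF el1 rc1 3(2) v1 N(2)] order_refl])
      fix s2
      assume "eliminated s2 \<and> s2 ''k'' 0 = int k \<and> (\<exists>N'. N < N' \<and> N' \<le> N + J \<and>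
        recorded s2 N' (\<lambda>c. (\<Sum>l<k. of_nat (weight l) * c l) + of_nat (weight k) * c k))"
      then obtain N' where el2: "eliminated s2" and kv2: "s2 ''k'' 0 = int k" and N': "N < N'" "N' \<le> N + J"
        and rc2: "recorded s2 N' (\<lambda>c. (\<Sum>l<k. of_nat (weight l) * c l) + of_nat (weight k) * c k)" by blast
      have b2: "bounded w s2" using el2 by (simp add: eliminated_def)
      let ?s = "s2(''k'' := (s2 ''k'')(aval (Num 0) s2 := aval (Add (V ''k'') (Num 1)) s2))"
      have "\<bar>int k + 1\<bar> < 2 ^ w" using 3(2) m_less_w by linarith
      then have "bounded w ?s" by (intro bounded_update[OF b2 boundedD[OF b2]]) (simp add: kv2)
      then have "eliminated ?s" by (rule eliminated_cong[OF el2]) simp_all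
      moreover have "recorded ?s N' (\<lambda>c. \<Sum>l<Suc k. of_nat (weight l) * c l)"
        using rc2 by (simp add: recorded_def)
      moreover have "?s ''k'' 0 = int (Suc k)" by (simp add: kv2)
      moreover have "Suc k \<le> N'" "N' \<le> Suc k * J" using N N' by auto
      ultimately have "I (Suc k) ?s" unfolding I_def by blast
      then show "runs w (Incr ''k'') s2 1 (I (Suc k))" by (rule runs_Write[OF b2])
    qed
  next
    case (4 s')
    then show ?case by (simp add: I_def)
  qed
qed

definition written :: "state \<Rightarrow> nat \<Rightarrow> bool" where
  "written s l \<longleftrightarrow> (\<forall>t<l. let k = nat (s ''K'' (int (t div m))) in
     s ''lnum'' (int t) = s ''R'' (int (t div m)) * bareiss Z k k (t mod m) \<and>
     s ''lden'' (int t) = D * int (weight k))"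

lemma write_vectors_runs:
  assumes el: "eliminated s" and rc: "recorded s N X" and "N \<le> m * J"
  shows "runs w write_vectors s (1 + (N * m + 1) * ((1 + (1 + (1 + (1 + 1)))) + 1))
    (\<lambda>s'. recorded s' N X \<and> written s' (N * m))"
proof -
  define I where "I t s' \<longleftrightarrow> eliminated s' \<and> recorded s' N X \<and> s' ''t'' 0 = int t \<and> written s' t"
    for t and s' :: state
  have b: "bounded w s" using el by (simp add: eliminated_def)
  have "N * m \<le> m * J * m" using assms by simp
  then have Nm: "int (N * m) < 2 ^ w" using count_less by linarith
  show ?thesis
    unfolding write_vectors_def
  proof (rule runs_Seq, rule runs_Write[OF b], rule runs_For[where I = I], goal_cases)
    case 1
    let ?s = "s(''t'' := (s ''t'')(aval (Num 0) s := aval (Num 0) s))"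
    have "bounded w ?s" by (rule bounded_update[OF b boundedD[OF b]]) simp
    then have "eliminated ?s" by (rule eliminated_cong[OF el]) simp_all
    then show ?case unfolding I_def using rc by (auto simp: recorded_def written_def)
  next
    case (2 t s')
    then show ?case by (simp add: I_def eliminated_def recorded_def)
  next
    case (3 t s')
    then have el': "eliminated s'" and rc': "recorded s' N X" and tv: "s' ''t'' 0 = int t"
      and wr: "written s' t" by (auto simp: I_def)
    have b': "bounded w s'" using el' by (simp add: eliminated_def)
    have mv: "s' ''m'' 0 = int m" using el' by (simp add: eliminated_def)
    define q i k r where "q = t div m" and "i = t mod m" and "k = nat (s' ''K'' (int q))"
      and "r = s' ''R'' (int q)"
    have q: "q < N" using 3(2) by (simp add: q_def less_mult_imp_div_less)
    have i: "i < m" using m_pos by (simp add: i_def)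
    have Kq: "s' ''K'' (int q) = int k" and k: "k < m" and r: "0 \<le> r" "r \<le> 2 ^ (2 * h)"
      using rc' q by (auto simp: recorded_def k_def r_def)
    define s1 where "s1 = s'(''q'' := (s' ''q'')(0 := int q))"
    define s2 where "s2 = s1(''k'' := (s1 ''k'')(0 := int k))"
    define s3 where "s3 = s2(''lnum'' := (s2 ''lnum'')(int t := r * bareiss Z k k i))"
    define s4 where "s4 = s3(''lden'' := (s3 ''lden'')(int t := D * int (weight k)))"
    define s5 where "s5 = s4(''t'' := (s4 ''t'')(0 := int (t + 1)))"
    note defs = s1_def s2_def s3_def s4_def s5_def
    have qt: "q \<le> t" by (simp add: q_def)
    have less1: "\<bar>int q\<bar> < 2 ^ w" "\<bar>int k\<bar> < 2 ^ w" "\<bar>int (t + 1)\<bar> < 2 ^ w"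
      using qt k m_less_w Nm 3(2) by linarith+
    \<comment> \<open>A root of at most \<open>2 ^ (2 * h)\<close> times an entry of at most
      \<open>2 ^ h\<close>: one of the two products that account for the \<open>3 * h\<close> in
      \<open>w_ge\<close>, the other being the denominator below.\<close>
    have less2: "\<bar>r * bareiss Z k k i\<bar> < 2 ^ w"
    proof (rule less_w[OF order_refl])
      have "\<bar>r\<bar> * \<bar>bareiss Z k k i\<bar> \<le> 2 ^ (2 * h) * 2 ^ h"
        using r bareiss_le[OF k k i] by (intro mult_mono) auto
      then show "\<bar>r * bareiss Z k k i\<bar> \<le> 2 ^ (3 * h)"
        by (simp add: abs_mult flip: power_add)
    qed
    have D0: "0 < D" unfolding D_def using den_pos by (intro prod_pos) auto
    have less3: "\<bar>D * int (weight k)\<bar> < 2 ^ w"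
    proof (rule less_w[OF order_refl])
      have "int (weight k) \<le> int (2 ^ (2 * h))" unfolding of_nat_le_iff by (rule weight_le[OF k])
      then have "D * int (weight k) \<le> 2 ^ h * 2 ^ (2 * h)"
        using D0 D_le by (intro mult_mono) auto
      then show "\<bar>D * int (weight k)\<bar> \<le> 2 ^ (3 * h)"
        using D0 by (simp add: abs_mult flip: power_add)
    qed
    have b1: "bounded w s1" unfolding s1_def by (rule bounded_update[OF b' boundedD[OF b'] less1(1)])
    have b2: "bounded w s2" unfolding s2_def by (rule bounded_update[OF b1 boundedD[OF b1] less1(2)])
    have b3: "bounded w s3" unfolding s3_def by (rule bounded_update[OF b2 boundedD[OF b2] less2])
    have b4: "bounded w s4" unfolding s4_def by (rule bounded_update[OF b3 boundedD[OF b3] less3])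
    have b5: "bounded w s5" unfolding s5_def by (rule bounded_update[OF b4 boundedD[OF b4] less1(3)])
    have v: "s1 ''q'' 0 = int q" "s1 ''K'' (int q) = int k" "s2 ''t'' 0 = int t" "s2 ''q'' 0 = int q"
      "s2 ''R'' (int q) = r" "s2 ''k'' 0 = int k" "s2 ''m'' 0 = int m" "s3 ''t'' 0 = int t"
      "s3 ''D'' 0 = D" "s4 ''t'' 0 = int t"
      using Kq mv tv el' by (simp_all add: defs r_def eliminated_def)
    have qv: "int t div int m = int q" by (simp add: q_def zdiv_int)
    have iv: "int t - int m * int q = int i" by (simp add: q_def i_def zdiv_int zmod_int minus_mult_div_eq_mod)
    have Fv: "s2 ''F'' (int k * (int m + 1) * int m + int i) = bareiss Z k k i"
    proof -
      have "int k * (int m + 1) * int m + int i = int ((k * m + k) * m + i)" by (simp add: algebra_simps)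
      moreover have "s' ''F'' (int ((k * m + k) * m + i)) = bareiss Z k k i"
        using el' k i unfolding eliminated_def by blast
      moreover have "s2 ''F'' = s' ''F''" by (simp add: defs)
      ultimately show ?thesis by (simp only:)
    qed
    have el3: "eliminated s3" by (rule eliminated_cong[OF el' b3]) (simp_all add: defs)
    have pv: "aval pivot_product s3 = int (weight k)"
      by (rule pivot_product_value[OF el3 _ k]) (simp add: defs)
    have tv1: "int t + 1 = int (t + 1)" by simp
    have "I (Suc t) s5"
      unfolding I_def
    proof (intro conjI)
      show "eliminated s5" by (rule eliminated_cong[OF el' b5]) (simp_all add: defs)
      show "recorded s5 N X" using rc' by (simp add: recorded_def defs)
      show "written s5 (Suc t)"
        using wr Kq by (auto simp: written_def defs less_Suc_eq Let_def q_def i_def r_def)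
    qed (simp add: s5_def)
    then show ?case
      by (intro runs_Seq runs_Write b', unfold aval.simps tv mv qv s1_def[symmetric],
          intro runs_Seq runs_Write b1, unfold aval.simps v s2_def[symmetric],
          intro runs_Seq runs_Write b2, unfold aval.simps v iv Fv s3_def[symmetric],
          intro runs_Seq runs_Write b3, unfold aval.simps v pv s4_def[symmetric],
          intro runs_Write b4, unfold aval.simps v tv1 s5_def[symmetric])
  next
    case (4 s')
    then show ?case by (simp add: I_def)
  qed
qed

text \<open>Counts that depend on the run through \<open>N\<close> are replaced by bounds in
  \<open>m\<close> and \<open>J\<close>, so that \<open>step_count_le\<close> can estimate one fixed
  expression.\<close>

lemma square_decomposition_runs:
  assumes "inputs s" "s ''t'' 0 = 0"
  shows "runs w square_decomposition s
    ((1 + (m * m + 1) * 3) + ((1 + (m * m + 1) * 3) + ((2 + (m * m * m + 1) * 5) +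
      ((1 + (m + 1) * (3 + (J + 1) * (4 * w + 11))) + (1 + (m * J * m + 1) * 6)))))
    (\<lambda>s'. \<exists>N. m \<le> N \<and> N \<le> m * J \<and>
      recorded s' N (\<lambda>c. \<Sum>k<m. of_nat (weight k) * c k) \<and> written s' (N * m))"
  unfolding square_decomposition_def
proof (rule runs_Seq, rule runs_mono[OF common_denominator_runs[OF assms]], simp,
    rule runs_Seq, rule runs_mono[OF clear_denominators_runs], blast, blast, simp,
    rule runs_Seq, rule runs_mono[OF eliminate_runs], assumption)
  have "1 + (1 + (a + 1) * (1 + (1 + (1 + 1)) + 1)) \<le> 2 + (c + 1) * 5" if "a \<le> c" for a c :: nat
    using that by simp
  moreover have "(m - 1) * m * m \<le> m * m * m" by (intro mult_right_mono) auto
  ultimately show "1 + (1 + ((m - 1) * m * m + 1) * (1 + (1 + (1 + 1)) + 1)) \<le> 2 + (m * m * m + 1) * 5"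
    by blast
next
  fix s3
  assume s3: "eliminated s3 \<and> s3 ''N'' 0 = 0"
  show "runs w (Seq split_pivots write_vectors) s3
      ((1 + (m + 1) * (3 + (J + 1) * (4 * w + 11))) + (1 + (m * J * m + 1) * 6))
    (\<lambda>s'. \<exists>N. m \<le> N \<and> N \<le> m * J \<and>
      recorded s' N (\<lambda>c. \<Sum>k<m. of_nat (weight k) * c k) \<and> written s' (N * m))"
  proof (rule runs_Seq, rule runs_mono[OF split_pivots_runs])
    fix s4
    assume "eliminated s4 \<and> (\<exists>N. m \<le> N \<and> N \<le> m * J \<and>
      recorded s4 N (\<lambda>c. \<Sum>k<m. of_nat (weight k) * c k))"
    then obtain N where s4: "eliminated s4" "recorded s4 N (\<lambda>c. \<Sum>k<m. of_nat (weight k) * c k)"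
      and N: "m \<le> N" "N \<le> m * J" by blast
    show "runs w write_vectors s4 (1 + (m * J * m + 1) * 6)
      (\<lambda>s'. \<exists>N. m \<le> N \<and> N \<le> m * J \<and>
        recorded s' N (\<lambda>c. \<Sum>k<m. of_nat (weight k) * c k) \<and> written s' (N * m))"
    proof (rule runs_mono[OF write_vectors_runs[OF s4 N(2)]])
      have "1 + (a + 1) * (1 + (1 + (1 + (1 + 1))) + 1) \<le> 1 + (c + 1) * 6" if "a \<le> c" for a c :: nat
        using that by simp
      moreover have "N * m \<le> m * J * m" using N by simp
      ultimately show "1 + (N * m + 1) * (1 + (1 + (1 + (1 + 1))) + 1) \<le> 1 + (m * J * m + 1) * 6" by blast
    qed (use N in blast)
  qed (use s3 in \<open>auto simp: algebra_simps\<close>)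
qed

section \<open>Correctness of the output vectors\<close>

lemma output_correct:
  assumes rc: "recorded s N (\<lambda>c. \<Sum>k<m. of_nat (weight k) * c k)" and wr: "written s (N * m)"
    and A: "A \<in> carrier_mat m m"
      "\<And>i j. i < m \<Longrightarrow> j < m \<Longrightarrow> A $$ (i, j) = of_int (Z i j) / (of_int D)\<^sup>2"
  shows "\<exists>ls. outputs_vectors s m ls \<and> set ls \<subseteq> carrier_vec m \<and> length ls = N \<and>
    A = mat_sum_list m (map outer_square ls)"
proof -
  define x :: "nat \<Rightarrow> nat \<Rightarrow> rat" where
    "x q i = of_int (s ''lnum'' (int (q * m + i))) / of_int (s ''lden'' (int (q * m + i)))" for q i
  define ls where "ls = map (\<lambda>q. vec m (x q)) [0..<N]"
  define K where "K q = nat (s ''K'' (int q))" for q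
  have Km: "K q < m" if "q < N" for q using rc that m_pos by (auto simp: recorded_def K_def)
  have D0: "0 < D" unfolding D_def using den_pos by (intro prod_pos) auto
  have cells: "s ''lnum'' (int (q * m + i)) = s ''R'' (int q) * bareiss Z (K q) (K q) i"
      "s ''lden'' (int (q * m + i)) = D * int (weight (K q))" if "q < N" "i < m" for q i
  proof -
    have "q * m + i < Suc q * m" using that by simp
    also have "\<dots> \<le> N * m" using that by (intro mult_right_mono) auto
    finally have "q * m + i < N * m" .
    moreover have "(q * m + i) div m = q" "(q * m + i) mod m = i" using that by simp_all
    ultimately show "s ''lnum'' (int (q * m + i)) = s ''R'' (int q) * bareiss Z (K q) (K q) i"
      "s ''lden'' (int (q * m + i)) = D * int (weight (K q))"
      using wr unfolding written_def K_def Let_def by metis+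
  qed
  have carr: "set ls \<subseteq> carrier_vec m" by (auto simp: ls_def)
  have "outputs_vectors s m ls"
    unfolding outputs_vectors_def
  proof (intro conjI allI impI)
    show "s ''N'' 0 = int (length ls)" using rc by (simp add: ls_def recorded_def)
    fix q i assume q: "q < length ls" and i: "i < m"
    show "0 < s ''lden'' (int (q * m + i))"
      using cells[of q i] q i D0 weight_pos[OF Km] by (simp add: ls_def)
    show "ls ! q $ i = of_int (s ''lnum'' (int (q * m + i))) / of_int (s ''lden'' (int (q * m + i)))"
      using q i by (simp add: ls_def x_def)
  qed (simp add: ls_def)
  moreover have "A = mat_sum_list m (map outer_square ls)"
    unfolding mat_sum_list_outer_squares[OF carr]
  proof (rule eq_matI)
    fix i j assume "i < dim_row (mat m m (\<lambda>(i, j). \<Sum>l\<leftarrow>ls. l $ i * l $ j))"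
      "j < dim_col (mat m m (\<lambda>(i, j). \<Sum>l\<leftarrow>ls. l $ i * l $ j))"
    then have ij: "i < m" "j < m" by auto
    \<comment> \<open>Entry \<open>(i, j)\<close> of the rank-one matrix of pivot \<open>k\<close>,
      divided by the square of the output denominator. Since \<open>recorded\<close> holds for all
      coefficients, this choice collapses the sum over squares to a weighted sum over
      pivots.\<close>
    define c :: "nat \<Rightarrow> rat" where "c k = of_int (bareiss Z k k i * bareiss Z k k j)
      / (of_int D * of_nat (weight k))\<^sup>2" for k
    have "(\<Sum>l\<leftarrow>ls. l $ i * l $ j) = (\<Sum>q<N. x q i * x q j)"
      using ij by (simp add: ls_def o_def interv_sum_list_conv_sum_set_nat atLeast0LessThan)
    also have "\<dots> = (\<Sum>q<N. (of_int (s ''R'' (int q)))\<^sup>2 * c (nat (s ''K'' (int q))))"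
    proof (rule sum.cong[OF refl])
      fix q assume "q \<in> {..<N}"
      then have q: "q < N" by simp
      show "x q i * x q j = (of_int (s ''R'' (int q)))\<^sup>2 * c (nat (s ''K'' (int q)))"
        unfolding x_def cells[OF q ij(1)] cells[OF q ij(2)] c_def K_def[symmetric]
        by (simp add: power2_eq_square)
    qed
    also have "\<dots> = (\<Sum>k<m. of_nat (weight k) * c k)" using rc by (simp add: recorded_def)
    also have "\<dots> = (\<Sum>k<m. of_int (bareiss Z k k i * bareiss Z k k j)
      / of_int (bareiss_pivot Z k * bareiss_pivot Z (Suc k)) / (of_int D)\<^sup>2)"
    proof (rule sum.cong[OF refl])
      fix k assume "k \<in> {..<m}"
      then have k: "k < m" by simp
      show "of_nat (weight k) * c k = of_int (bareiss Z k k i * bareiss Z k k j)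
        / of_int (bareiss_pivot Z k * bareiss_pivot Z (Suc k)) / (of_int D)\<^sup>2"
        unfolding int_weight[OF k, symmetric] c_def
        using weight_pos[OF k] D0 by (simp add: field_simps power2_eq_square)
    qed
    also have "\<dots> = of_int (Z i j) / (of_int D)\<^sup>2"
      unfolding bareiss_decomposition[OF ij] sum_divide_distrib ..
    finally show "A $$ (i, j) = mat m m (\<lambda>(i, j). \<Sum>l\<leftarrow>ls. l $ i * l $ j) $$ (i, j)"
      using ij A by simp
  qed (use A in auto)
  ultimately show ?thesis using carr by (intro exI[of _ ls]) (auto simp: ls_def)
qed

end

section \<open>Bit-length estimates and the final constants\<close>

lemma sum_square_grid:
  fixes f :: "nat \<Rightarrow> nat"
  shows "(\<Sum>t<n * m. f t) = (\<Sum>i<n. \<Sum>j<m. f (i * m + j))"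
proof -
  have "sum f {i * m..<i * m + m} = (\<Sum>j<m. f (i * m + j))" for i
    by (subst sum.atLeastLessThan_shift_0) (simp add: atLeast0LessThan o_def)
  then show ?thesis by (simp flip: sum.nat_group)
qed

text \<open>Rational test vectors are embedded into the reals; the embedding preserves the value of
  the form and its sign.\<close>

lemma positive_definite_form:
  assumes A: "A \<in> carrier_mat m m" and pd: "positive_definite (map_mat real_of_rat A)"
  shows "pos_def_form m (\<lambda>i j. A $$ (i, j))"
  unfolding pos_def_form_def
proof (intro allI impI)
  fix x :: "nat \<Rightarrow> rat"
  assume "\<exists>i<m. x i \<noteq> 0"
  then obtain i where i: "i < m" "x i \<noteq> 0" by blast
  define v where "v = vec m (\<lambda>i. real_of_rat (x i))"
  have "v \<noteq> 0\<^sub>v m"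
  proof
    assume "v = 0\<^sub>v m"
    then have "v $ i = 0" using i by simp
    then show False using i by (simp add: v_def)
  qed
  then have "0 < v \<bullet> (map_mat real_of_rat A *\<^sub>v v)"
    using pd A by (auto simp: positive_definite_def v_def)
  also have "\<dots> = real_of_rat (\<Sum>i<m. \<Sum>j<m. x i * A $$ (i, j) * x j)"
    using A by (simp add: v_def scalar_prod_def of_rat_sum of_rat_mult sum_distrib_left
      atLeast0LessThan mult.assoc)
  finally show "0 < (\<Sum>i<m. \<Sum>j<m. x i * A $$ (i, j) * x j)" by simp
qed

lemma two_power_le: "c \<le> d \<Longrightarrow> \<bar>v :: int\<bar> \<le> 2 ^ c \<Longrightarrow> \<bar>v\<bar> \<le> 2 ^ d"
  using power_increasing[of c d "2::int"] by linarith

text \<open>The dominant contribution is the bisection inside the square splitting, about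
  \<open>m * J * w\<close>, with each factor at most linear in \<open>\<beta>\<close>.\<close>

lemma step_count_le:
  fixes m J w \<beta> :: nat
  assumes "1 \<le> \<beta>" "m \<le> \<beta>" "m * m \<le> \<beta>" "m * m * m \<le> \<beta>" "J \<le> 9 * \<beta>" "w = 24 * \<beta>"
  shows "(1 + (m * m + 1) * 3) + ((1 + (m * m + 1) * 3) + ((2 + (m * m * m + 1) * 5) +
      ((1 + (m + 1) * (3 + (J + 1) * (4 * w + 11))) + (1 + (m * J * m + 1) * 6)))) \<le> 3000 * \<beta> ^ 3"
proof -
  have b2: "\<beta> \<le> \<beta> * \<beta>" "\<beta> * \<beta> \<le> \<beta> * \<beta> * \<beta>" using assms(1) by simp_all
  \<comment> \<open>Here \<open>J + 1 \<le> 10 * \<beta>\<close>, and \<open>4 * w + 11\<close> is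
    at most \<open>(96 + 11) * \<beta>\<close>.\<close>
  have "(J + 1) * (4 * w + 11) \<le> (10 * \<beta>) * (107 * \<beta>)"
    using assms by (intro mult_mono) auto
  also have "\<dots> = 1070 * (\<beta> * \<beta>)" by simp
  finally have "3 + (J + 1) * (4 * w + 11) \<le> 1073 * (\<beta> * \<beta>)" using assms(1) b2 by linarith
  then have "(m + 1) * (3 + (J + 1) * (4 * w + 11)) \<le> (2 * \<beta>) * (1073 * (\<beta> * \<beta>))"
    using assms by (intro mult_mono) auto
  also have "\<dots> = 2146 * (\<beta> * \<beta> * \<beta>)" by simp
  finally have 1: "(m + 1) * (3 + (J + 1) * (4 * w + 11)) \<le> 2146 * (\<beta> * \<beta> * \<beta>)" .
  have "m * m * J \<le> \<beta> * (9 * \<beta>)" using assms by (intro mult_mono) auto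
  then have 2: "m * J * m \<le> 9 * (\<beta> * \<beta>)" by (simp add: ac_simps)
  have "(1 + (a + 1) * 3) + ((1 + (a + 1) * 3) + ((2 + (c + 1) * 5) + ((1 + d) + (1 + (e + 1) * 6))))
      \<le> 3000 * p"
    if "a \<le> \<beta>" "c \<le> \<beta>" "d \<le> 2146 * p" "e \<le> 9 * q" "\<beta> \<le> q" "q \<le> p" for a c d e p q :: nat
    using that assms(1) unfolding add_mult_distrib by linarith
  from this[OF assms(3,4) 1 2 b2] show ?thesis by (simp only: power3_eq_cube)
qed

theorem theorem6p10:
  shows "\<exists>(P :: com) (c :: nat) (k :: nat) (C :: real).
    \<forall>(m :: nat) (b :: nat) (A :: rat mat).
      1 \<le> m \<and> A \<in> carrier_mat m m \<and> symmetric_mat A \<and>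
      positive_definite (map_mat real_of_rat A) \<and> bit_length A = b \<longrightarrow>
      (\<exists>(t :: nat) (s :: state) (ls :: rat vec list).
         exec P (input_state A) t s \<and> t \<le> c * (m + b) ^ k \<and>
         outputs_vectors s m ls \<and> set ls \<subseteq> carrier_vec m \<and>
         m \<le> length ls \<and>
         real (length ls) \<le> C * (real m * (log 2 (real m) + log 2 (real b))) \<and>
         A = mat_sum_list m (map outer_square ls))"
\<comment> \<open>At most \<open>3000 * \<beta> ^ 3\<close> units, each quadratic in
  \<open>25 * \<beta>\<close>, give the power \<open>\<beta> ^ 5 = b ^ 10\<close>. The 13 absorbs
  \<open>11 + 2 * log 2 b\<close>, because \<open>log 2 b\<close> is at least 1.\<close>
proof (rule exI[of _ square_decomposition],
    rule exI[of _ "3000 * ccoeff square_decomposition * 25\<^sup>2"], rule exI[of _ 10],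
    rule exI[of _ 13], intro allI impI)
  fix m b :: nat and A :: "rat mat"
  assume "1 \<le> m \<and> A \<in> carrier_mat m m \<and> symmetric_mat A \<and>
      positive_definite (map_mat real_of_rat A) \<and> bit_length A = b"
  then have m: "1 \<le> m" and A: "A \<in> carrier_mat m m" and sym: "symmetric_mat A"
    and pd: "positive_definite (map_mat real_of_rat A)" and b: "bit_length A = b" by auto
  define num where "num t = fst (quotient_of (A $$ (t div m, t mod m)))" for t
  define den where "den t = snd (quotient_of (A $$ (t div m, t mod m)))" for t
  define D where "D = (\<Prod>t<m * m. den t)"
  define Z where "Z i j = D * (D div den (i * m + j)) * num (i * m + j)" for i j
  \<comment> \<open>Entries of \<open>Z\<close> are products of three numbers of at most
    \<open>2 ^ b\<close> in absolute value, so minors are bounded with exponent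
    \<open>m * m + 3 * b * m\<close>, at most \<open>4 * \<beta>\<close>; this is \<open>h\<close>.
    The choice of \<open>w\<close> exceeds \<open>3 * h + 2\<close> and leaves room for the loop
    counters.\<close>
  define \<beta> where "\<beta> = b * b"
  define h where "h = 4 * \<beta>"
  define J where "J = ceillog2 (2 * h) + 7"
  define w where "w = 24 * \<beta>"
  have den_pos: "0 < den t" for t by (simp add: den_def quotient_of_denom_pos')
  have D_pos: "0 < D" unfolding D_def by (intro prod_pos) (simp add: den_pos)
  have b_sum: "b = (\<Sum>t<m * m. int_size (num t) + int_size (den t))"
    unfolding sum_square_grid b[symmetric] using A
    by (auto simp: bit_length_def rat_size_def num_def den_def intro!: sum.cong)
  \<comment> \<open>A positive denominator has size at least 2 and a numerator at least 1. So
    \<open>b\<close> is at least 3 even for \<open>m = 1\<close>, where \<open>log 2 m = 0\<close>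
    and \<open>log 2 b\<close> alone must absorb the constants.\<close>
  have size3: "3 \<le> int_size (num t) + int_size (den t)" for t
  proof -
    have "\<not> int_size (den t) \<le> Suc 0" unfolding int_size_le_iff using den_pos[of t] by simp
    then show ?thesis using int_size_pos[of "num t"] by linarith
  qed
  have mb: "3 * (m * m) \<le> b"
    unfolding b_sum 
    using sum_mono[of "{..<m * m}" "\<lambda>_. 3" "\<lambda>t. int_size (num t) + int_size (den t)"] size3 by simp
  have "m \<le> m * m" using m by simp
  then have b3: "3 \<le> b" and m_le: "m \<le> b" "m * m \<le> b" using mb m by linarith+
  have \<beta>: "3 * b \<le> \<beta>" using b3 by (simp add: \<beta>_def)
  have mmm: "m * m * m \<le> \<beta>" unfolding \<beta>_def using m_le by (intro mult_mono) auto
  have D_le: "D \<le> 2 ^ b"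
  proof -
    have "D \<le> (\<Prod>t<m * m. 2 ^ int_size (den t))"
      unfolding D_def
    proof (intro prod_mono conjI)
      fix t
      have "(2::int) ^ (int_size (den t) - 1) \<le> 2 ^ int_size (den t)" by (intro power_increasing) auto
      then show "den t \<le> 2 ^ int_size (den t)"
        using abs_less_two_power_int_size[of "den t"] by linarith
    qed (simp add: den_pos less_imp_le)
    also have "\<dots> = 2 ^ (\<Sum>t<m * m. int_size (den t))" by (simp add: power_sum)
    also have "\<dots> \<le> 2 ^ b" unfolding b_sum by (intro power_increasing sum_mono) auto
    finally show ?thesis .
  qed
  have num_den_le: "\<bar>num t\<bar> \<le> 2 ^ b" "\<bar>den t\<bar> \<le> 2 ^ b" if "t < m * m" for t
  proof -
    have "int_size (num t) + int_size (den t) \<le> b"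
      unfolding b_sum using that by (intro member_le_sum) auto
    then have "int_size (num t) \<le> Suc b" "int_size (den t) \<le> Suc b" by linarith+
    then show "\<bar>num t\<bar> \<le> 2 ^ b" "\<bar>den t\<bar> \<le> 2 ^ b" unfolding int_size_le_iff by linarith+
  qed
  have pos_less: "i * m + j < m * m" if "i < m" "j < m" for i j
  proof -
    have "i * m + j < Suc i * m" using that by simp
    also have "\<dots> \<le> m * m" using that by (intro mult_right_mono) auto
    finally show ?thesis .
  qed
  have Z_le: "\<bar>Z i j\<bar> \<le> 2 ^ (3 * b)" if "i < m" "j < m" for i j
  proof -
    have "\<bar>D div den (i * m + j)\<bar> \<le> 2 ^ b" using abs_div_le[of D "den (i * m + j)"] D_pos D_le by linarith
    then have "\<bar>D\<bar> * \<bar>D div den (i * m + j)\<bar> * \<bar>num (i * m + j)\<bar> \<le> 2 ^ b * 2 ^ b * 2 ^ b"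
      using D_pos D_le num_den_le(1)[OF pos_less[OF that]] by (intro mult_mono) auto
    moreover have "(2::int) ^ b * 2 ^ b * 2 ^ b = 2 ^ (3 * b)"
      unfolding power_add[symmetric] by (rule arg_cong[of _ _ "(^) 2"]) simp
    ultimately show ?thesis by (simp only: Z_def abs_mult)
  qed
  have Z_rat: "rat_of_int (Z i j) = (of_int D)\<^sup>2 * A $$ (i, j)" if "i < m" "j < m" for i j
  proof -
    let ?t = "i * m + j"
    have "den ?t dvd D" unfolding D_def using pos_less[OF that] by (intro dvd_prodI) auto
    then have "rat_of_int (D div den ?t) = of_int D / of_int (den ?t)"
      using den_pos[of ?t] by (auto elim!: dvdE)
    moreover have "A $$ (i, j) = of_int (num ?t) / of_int (den ?t)"
      using quotient_of_div[of "A $$ (i, j)" "num ?t" "den ?t"] that by (simp add: num_def den_def)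
    ultimately show ?thesis by (simp add: Z_def power2_eq_square)
  qed
  have A_sym: "A $$ (i, j) = A $$ (j, i)" if "i < m" "j < m" for i j
    using sym A that unfolding symmetric_mat_def by (metis carrier_matD index_transpose_mat(1))
  have bareiss_le: "\<bar>bareiss Z k i j\<bar> \<le> 2 ^ h" if "k < m" "i < m" "j < m" for k i j
  proof (rule two_power_le)
    have "3 * b * m \<le> 3 * \<beta>" unfolding \<beta>_def using m_le by simp
    then show "m * m + 3 * b * m \<le> h" using m_le \<beta> unfolding h_def by linarith
    show "\<bar>bareiss Z k i j\<bar> \<le> 2 ^ (m * m + 3 * b * m)" by (rule abs_bareiss_le[OF Z_le that])
  qed
  have J_le: "J \<le> 9 * \<beta>"
  proof -
    have "ceillog2 (2 * h) \<le> 2 * h"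
      using \<beta> b3 by (subst ceillog2_le_iff) (auto simp: h_def less_imp_le)
    then show ?thesis using \<beta> b3 by (simp add: J_def h_def)
  qed
  interpret square_sum_run m Z num den D h w J
  proof unfold_locales
    show "Z i j = Z j i" if "i < m" "j < m" for i j
      using Z_rat[of i j] Z_rat[of j i] A_sym[of i j] that by (metis of_int_eq_iff)
    show "pos_def_form m (\<lambda>i j. rat_of_int (Z i j))"
      unfolding pos_def_form_def
    proof (intro allI impI)
      fix x :: "nat \<Rightarrow> rat" assume "\<exists>i<m. x i \<noteq> 0"
      then have "0 < (\<Sum>i<m. \<Sum>j<m. x i * A $$ (i, j) * x j)"
        using positive_definite_form[OF A pd] by (simp add: pos_def_form_def)
      then have "0 < (of_int D)\<^sup>2 * (\<Sum>i<m. \<Sum>j<m. x i * A $$ (i, j) * x j)" using D_pos by simp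
      also have "\<dots> = (\<Sum>i<m. \<Sum>j<m. x i * rat_of_int (Z i j) * x j)"
        unfolding sum_distrib_left by (intro sum.cong refl) (simp add: Z_rat)
      finally show "0 < (\<Sum>i<m. \<Sum>j<m. x i * rat_of_int (Z i j) * x j)" .
    qed
    show "D \<le> 2 ^ h" using two_power_le[of b h D] D_le D_pos \<beta> by (simp add: h_def)
    show "3 * h + 2 \<le> w" using \<beta> b3 by (simp add: h_def w_def)
    have less: "int v < 2 ^ w" if "v < 2 ^ w" for v :: nat
      using that by (metis of_nat_less_iff of_nat_numeral of_nat_power)
    show "int (m * m * m) < 2 ^ w"
    proof (rule less)
      have "m * m * m < 2 ^ \<beta>" using mmm less_exp[of \<beta>] by linarith
      also have "(2::nat) ^ \<beta> \<le> 2 ^ w" by (intro power_increasing) (auto simp: w_def)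
      finally show "m * m * m < 2 ^ w" .
    qed
    show "int (m * J * m) < 2 ^ w"
    proof (rule less)
      have "m * m * J \<le> \<beta> * (9 * \<beta>)" using m_le \<beta> J_le by (intro mult_mono) auto
      also have "\<dots> < 2 ^ \<beta> * 2 ^ (9 * \<beta>)" by (intro mult_strict_mono) auto
      also have "\<dots> = (2::nat) ^ (10 * \<beta>)" by (simp flip: power_add)
      also have "\<dots> \<le> 2 ^ w" by (intro power_increasing) (auto simp: w_def)
      finally show "m * J * m < 2 ^ w" by (simp add: ac_simps)
    qed
    show "greedy_squares n \<le> J" if "n \<le> 2 ^ (2 * h)" for n
      unfolding J_def
    proof (rule greedy_squares_le)
      \<comment> \<open>Rounding the exponent \<open>2 * h\<close> up to a power of two brings the
        bound into the doubly exponential form of \<open>greedy_squares_le\<close>.\<close>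
      have "(2::nat) ^ (2 * h) \<le> 2 ^ (2 ^ ceillog2 (2 * h))"
        by (intro power_increasing le_two_power_ceillog2) auto
      moreover have "(0::nat) < 2 ^ (2 ^ ceillog2 (2 * h))" by simp
      ultimately show "n < 4 * 2 ^ (2 ^ ceillog2 (2 * h))" using that by linarith
    qed
  qed (use m in \<open>auto simp: D_def Z_def den_pos bareiss_le\<close>)
  have in_m: "input_state A ''m'' 0 = int m" using A by (simp add: input_state_def)
  have in_cells: "input_state A ''num'' (int t) = num t" "input_state A ''den'' (int t) = den t"
    if "t < m * m" for t
  proof -
    have "int t < int m * int m" using that by (metis of_nat_less_iff of_nat_mult)
    then show "input_state A ''num'' (int t) = num t" "input_state A ''den'' (int t) = den t"
      using A by (simp_all add: input_state_def num_def den_def nat_div_distrib nat_mod_distrib)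
  qed
  have "bounded w (input_state A)"
    unfolding bounded_def
  proof (intro allI)
    fix x i
    have bw: "b \<le> 3 * h" using \<beta> by (simp add: h_def)
    consider "x = ''m''" "i = 0" | t where "t < m * m" "i = int t" "x = ''num''"
      | t where "t < m * m" "i = int t" "x = ''den''" | "input_state A x i = 0"
    proof (cases "(x = ''num'' \<or> x = ''den'') \<and> 0 \<le> i \<and> i < int m * int m")
      case True
      then have "nat i < m * m" "i = int (nat i)" by (auto simp: nat_less_iff)
      then show ?thesis using True that(2,3) by metis
    next
      case False
      then have "x = ''m'' \<and> i = 0 \<or> input_state A x i = 0"
        using A by (simp add: input_state_def Let_def) blast
      then show ?thesis using that(1,4) by blast
    qed
    then show "\<bar>input_state A x i\<bar> < 2 ^ w"
    proof cases
      case 1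
      then show ?thesis using in_m m_less_w by simp
    next
      case (2 t)
      then show ?thesis using in_cells num_den_le less_w[OF bw] by simp
    next
      case (3 t)
      then show ?thesis using in_cells num_den_le less_w[OF bw] by simp
    qed simp
  qed
  moreover have "input_state A ''N'' 0 = 0" by (simp add: input_state_def Let_def)
  ultimately have "inputs (input_state A)"
    using in_m in_cells by (simp add: inputs_def)
  moreover have "input_state A ''t'' 0 = 0" by (simp add: input_state_def Let_def)
  ultimately obtain t s N where ex: "exec square_decomposition (input_state A) t s"
    and t: "t \<le> ((1 + (m * m + 1) * 3) + ((1 + (m * m + 1) * 3) + ((2 + (m * m * m + 1) * 5) +
      ((1 + (m + 1) * (3 + (J + 1) * (4 * w + 11))) + (1 + (m * J * m + 1) * 6)))))
      * (ccoeff square_decomposition * (Suc w)\<^sup>2)"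
    and N: "m \<le> N" "N \<le> m * J"
    and out: "recorded s N (\<lambda>c. \<Sum>k<m. of_nat (weight k) * c k)" "written s (N * m)"
    using square_decomposition_runs unfolding runs_def by blast
  obtain ls where ls: "outputs_vectors s m ls" "set ls \<subseteq> carrier_vec m" "length ls = N"
    "A = mat_sum_list m (map outer_square ls)"
    using output_correct[OF out A] Z_rat D_pos by auto
  have "t \<le> 3000 * ccoeff square_decomposition * 25\<^sup>2 * (m + b) ^ 10"
  proof -
    have "Suc w \<le> 25 * \<beta>" using \<beta> b3 by (simp add: w_def)
    then have "(Suc w)\<^sup>2 \<le> (25 * \<beta>)\<^sup>2" by (rule power_mono) simp
    then have "t \<le> (3000 * \<beta> ^ 3) * (ccoeff square_decomposition * (25 * \<beta>)\<^sup>2)"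
      using \<beta> b3 m_le mmm J_le
      by (intro order_trans[OF t] mult_mono step_count_le mult_left_mono) (auto simp: w_def)
    also have "\<dots> = 3000 * ccoeff square_decomposition * 25\<^sup>2 * b ^ 10"
      by (simp add: \<beta>_def power_mult_distrib flip: power_add power_mult)
    also have "\<dots> \<le> 3000 * ccoeff square_decomposition * 25\<^sup>2 * (m + b) ^ 10"
      by (intro mult_left_mono power_mono) auto
    finally show ?thesis .
  qed
  moreover have "real (length ls) \<le> 13 * (real m * (log 2 (real m) + log 2 (real b)))"
  proof -
    have log_8: "log 2 (8::real) = 3" using log_nat_power[of 2 2 3] by simp
    have log_m: "0 \<le> log 2 (real m)" using m by simp
    have log_b: "1 \<le> log 2 (real b)" using b3 by (simp add: le_log_iff)
    have "real (ceillog2 (2 * h)) \<le> log 2 (real (2 * h)) + 1"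
      using ceillog2_less_log[of "2 * h"] \<beta> b3 by (simp add: h_def less_imp_le)
    also have "real (2 * h) = 2 ^ 3 * (real b)\<^sup>2" by (simp add: h_def \<beta>_def power2_eq_square)
    also have "log 2 \<dots> = 3 + 2 * log 2 (real b)"
      using b3 by (simp add: log_mult log_nat_power log_8)
    finally have "real J \<le> 11 + 2 * log 2 (real b)" by (simp add: J_def)
    also have "\<dots> \<le> 13 * (log 2 (real m) + log 2 (real b))"
      using log_b log_m by (simp add: distrib_left)
    finally have "real m * real J \<le> real m * (13 * (log 2 (real m) + log 2 (real b)))"
      by (intro mult_left_mono) auto
    also have "\<dots> = 13 * (real m * (log 2 (real m) + log 2 (real b)))" by simp
    finally have "real m * real J \<le> 13 * (real m * (log 2 (real m) + log 2 (real b)))" .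
    moreover have "real N \<le> real m * real J" using N(2) by (metis of_nat_le_iff of_nat_mult)
    ultimately show ?thesis unfolding ls(3) by linarith
  qed
  ultimately show "\<exists>t s ls. exec square_decomposition (input_state A) t s \<and>
      t \<le> 3000 * ccoeff square_decomposition * 25\<^sup>2 * (m + b) ^ 10 \<and>
      outputs_vectors s m ls \<and> set ls \<subseteq> carrier_vec m \<and> m \<le> length ls \<and>
      real (length ls) \<le> 13 * (real m * (log 2 (real m) + log 2 (real b))) \<and>
      A = mat_sum_list m (map outer_square ls)"
    using ex ls N(1) by blast
qed

end
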